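(* Let $F:\Delta\to\mathbb R^n$ be real-analytic on $\Delta$. If $J(\sigma)$ is nonsingular at every solution $\sigma$ of ${\rm VI}(F,\Delta)$, then ${\rm VI}(F,\Delta)$ has an odd number of solutions.
   Context: $\Delta=\{\sigma\in\mathbb R^n:\sigma\ge0,\ \mathbf 1^\top\sigma=1\}$, $\mathbf 1$ is the all-ones vector. Real-analytic on $\Delta$ means extending to a real-analytic map on a neighborhood of $\Delta$. A solution of ${\rm VI}(F,\Delta)$ is $\sigma^\star\in\Delta$ with $\langle F(\sigma^\star),\sigma'-\sigma^\star\rangle\ge0$ for all $\sigma'\in\Delta$. For a matrix $A$ and vector $b$, $A\circ b=A\,{\rm diag}(b)$ and $b\circ A={\rm diag}(b)A$. With $\partial F(\sigma)/\partial\sigma$ the Jacobian of $F$, $$J(\sigma)=(I-\mathbf 1\sigma^\top)\left(\frac{\partial F(\sigma)}{\partial\sigma}\circ\sigma+\left((I-\mathbf 1\sigma^\top)F(\sigma)\right)\circ I\right)(I-\mathbf 1\sigma^\top)+k\mathbf 1\sigma^\top,$$ where $k\ne0$ is a fixed real scalar (its value does not affect whether $J(\sigma)$ is nonsingular; the term removes the inherent zero eigenvalue with eigenvector $\mathbf 1$). *)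

theory Defs
  imports "HOL-Analysis.Analysis"
begin

definition prob_simplex :: "(real ^ 'n) set" where
  "prob_simplex = {\<sigma>. (\<forall>i. 0 \<le> \<sigma> $ i) \<and> (\<Sum>i\<in>UNIV. \<sigma> $ i) = 1}"

text \<open>
  Multivariate power series around \<open>a\<close>: the index \<open>\<alpha>\<close> ranges over all multi-indices.
  Convergence is unconditional (equivalently, absolute), as expressed by \<^const>\<open>has_sum\<close>.
\<close>

definition real_analytic_at :: "(real ^ 'n \<Rightarrow> real ^ 'm) \<Rightarrow> real ^ 'n \<Rightarrow> bool" where
  "real_analytic_at f a \<longleftrightarrow>
     (\<exists>r>0. \<exists>c :: ('n \<Rightarrow> nat) \<Rightarrow> real ^ 'm. \<forall>x\<in>ball a r.
        ((\<lambda>\<alpha>. (\<Prod>i\<in>UNIV. (x $ i - a $ i) ^ \<alpha> i) *\<^sub>R c \<alpha>) has_sum f x) UNIV)"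

definition real_analytic_on :: "(real ^ 'n \<Rightarrow> real ^ 'm) \<Rightarrow> (real ^ 'n) set \<Rightarrow> bool" where
  "real_analytic_on f U \<longleftrightarrow> (\<forall>a\<in>U. real_analytic_at f a)"

text \<open>
  A function \<open>F\<close> is real-analytic on an arbitrary (not necessarily open) set \<open>S\<close> if it has an
  analytic extension \<open>G\<close>. The values of \<open>F\<close> outside \<open>S\<close> are irrelevant.
\<close>

definition analytic_extension ::
    "(real ^ 'n \<Rightarrow> real ^ 'm) \<Rightarrow> (real ^ 'n) set \<Rightarrow> (real ^ 'n \<Rightarrow> real ^ 'm) \<Rightarrow> bool" where
  "analytic_extension F S G \<longleftrightarrow>
     (\<exists>U. open U \<and> S \<subseteq> U \<and> real_analytic_on G U) \<and> (\<forall>x\<in>S. G x = F x)"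

definition VI_solutions :: "(real ^ 'n \<Rightarrow> real ^ 'n) \<Rightarrow> (real ^ 'n) set \<Rightarrow> (real ^ 'n) set" where
  "VI_solutions F S = {\<sigma> \<in> S. \<forall>\<sigma>'\<in>S. F \<sigma> \<bullet> (\<sigma>' - \<sigma>) \<ge> 0}"

definition diag_mat :: "real ^ 'n \<Rightarrow> real ^ 'n ^ 'n" where
  "diag_mat b = (\<chi> i j. if i = j then b $ i else 0)"

definition mat_circ_vec :: "real ^ 'n ^ 'n \<Rightarrow> real ^ 'n \<Rightarrow> real ^ 'n ^ 'n" where
  "mat_circ_vec A b = A ** diag_mat b"

definition vec_circ_mat :: "real ^ 'n \<Rightarrow> real ^ 'n ^ 'n \<Rightarrow> real ^ 'n ^ 'n" where
  "vec_circ_mat b A = diag_mat b ** A"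

definition outer_product :: "real ^ 'n \<Rightarrow> real ^ 'n \<Rightarrow> real ^ 'n ^ 'n" where
  "outer_product a b = (\<chi> i j. a $ i * b $ j)"

definition simplex_proj :: "real ^ 'n \<Rightarrow> real ^ 'n ^ 'n" where
  "simplex_proj \<sigma> = mat 1 - outer_product 1 \<sigma>"

text \<open>
  The simplex has empty interior, so the Jacobian is that of an analytic extension \<open>G\<close> of \<open>F\<close>.
  For \<open>\<sigma>\<close> in the simplex the matrix below does not depend on the choice of \<open>G\<close>: the Jacobian is
  only applied to the vectors \<open>diag \<sigma> (I - 1 \<sigma>\<^sup>T) v\<close>, which are tangent to the simplex at \<open>\<sigma>\<close>
  and supported where \<open>\<sigma>\<close> is positive.
\<close>

definition J_mat :: "real \<Rightarrow> (real ^ 'n \<Rightarrow> real ^ 'n) \<Rightarrow> real ^ 'n \<Rightarrow> real ^ 'n ^ 'n" where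
  "J_mat k G \<sigma> =
     simplex_proj \<sigma> **
       (mat_circ_vec (jacobian G (at \<sigma>)) \<sigma> + vec_circ_mat (simplex_proj \<sigma> *v G \<sigma>) (mat 1)) **
       simplex_proj \<sigma>
     + k *\<^sub>R outer_product 1 \<sigma>"

end

theory Submission
  imports Defs
begin

text \<open>
  Let \<open>P\<close> be the nearest-point projection onto the simplex. The solutions correspond bijectively
  to the zeros of the normal map \<open>z \<mapsto> z - P z + G (P z)\<close>, which is Lipschitz, a bounded
  perturbation of the identity, and differentiable off finitely many hyperplanes. Invertibility of
  \<open>J\<close> at a solution forces strict complementarity, so that \<open>P\<close> is affine near the
  corresponding zero, and makes the derivative of the normal map there injective.

  It remains to see that a Lipschitz map \<open>g\<close> that is the identity outside a ball, is differentiable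
  almost everywhere, and has only nondegenerate zeros has an odd number of them. First, if \<open>f\<close> is
  Lipschitz and the identity outside a ball \<open>B\<close>, then the integral of \<open>det f'\<close> over \<open>B\<close> is
  the volume of \<open>B\<close>: for small \<open>t > 0\<close> the map \<open>id + t (f - id)\<close> permutes \<open>B\<close>, so the
  claim for it is the change of variables formula, and its Jacobian determinant is a polynomial in
  \<open>t\<close>, hence determined at \<open>t = 1\<close> by small \<open>t\<close>. Now apply this to \<open>f\<close> obtained from
  \<open>g\<close> by radially retracting its values onto a small ball around \<open>0\<close> and rescaling: \<open>det f'\<close>
  vanishes away from the zeros of \<open>g\<close>, and each zero contributes plus or minus the volume of
  \<open>B\<close>. So the signs sum to \<open>1\<close>.
\<close>

section \<open>Strict differentiability\<close>

text \<open>Both points vary in the estimate, not only one against \<open>a\<close>. The bound at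
  the single point \<open>a\<close> therefore controls \<open>f\<close> on a whole neighbourhood: a
  Lipschitz bound and, for injective \<open>A\<close>, local injectivity. Differentiability at the
  neighbouring points is not presupposed.\<close>

definition has_strict_derivative ::
    "('a::real_normed_vector \<Rightarrow> 'b::real_normed_vector) \<Rightarrow> ('a \<Rightarrow> 'b) \<Rightarrow> 'a \<Rightarrow> bool" where
  "has_strict_derivative f A a \<longleftrightarrow> bounded_linear A \<and>
     (\<forall>e>0. \<exists>d>0. \<forall>x\<in>ball a d. \<forall>y\<in>ball a d. norm (f x - f y - A (x - y)) \<le> e * norm (x - y))"

lemma has_strict_derivativeI:
  assumes "bounded_linear A"
    and "\<And>e. e > 0 \<Longrightarrow> \<exists>d>0. \<forall>x\<in>ball a d. \<forall>y\<in>ball a d. norm (f x - f y - A (x - y)) \<le> e * norm (x - y)"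
  shows "has_strict_derivative f A a"
  using assms unfolding has_strict_derivative_def by blast

lemma has_strict_derivativeD:
  assumes "has_strict_derivative f A a" "e > 0"
  obtains d where "d > 0"
    "\<And>x y. x \<in> ball a d \<Longrightarrow> y \<in> ball a d \<Longrightarrow> norm (f x - f y - A (x - y)) \<le> e * norm (x - y)"
  using assms unfolding has_strict_derivative_def by blast

lemma has_strict_derivative_bounded_linear: "has_strict_derivative f A a \<Longrightarrow> bounded_linear A"
  by (simp add: has_strict_derivative_def)

lemma has_strict_derivative_imp_has_derivative:
  assumes "has_strict_derivative f A a"
  shows "(f has_derivative A) (at a)"
  unfolding has_derivative_at_alt
proof (intro conjI allI impI)
  show "bounded_linear A"
    using assms by (rule has_strict_derivative_bounded_linear)
  fix e :: real assume "e > 0"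
  then obtain d where "d > 0" and d: "\<And>x y. x \<in> ball a d \<Longrightarrow> y \<in> ball a d \<Longrightarrow>
      norm (f x - f y - A (x - y)) \<le> e * norm (x - y)"
    using has_strict_derivativeD[OF assms] by blast
  then show "\<exists>d>0. \<forall>y. norm (y - a) < d \<longrightarrow> norm (f y - f a - A (y - a)) \<le> e * norm (y - a)"
    by (metis centre_in_ball dist_commute dist_norm mem_ball)
qed

lemma has_strict_derivative_locally_Lipschitz:
  assumes "has_strict_derivative f A a"
  obtains d B where "d > 0" "B > 0"
    "\<And>x y. x \<in> ball a d \<Longrightarrow> y \<in> ball a d \<Longrightarrow> norm (f x - f y) \<le> B * norm (x - y)"
proof -
  obtain d where d: "d > 0" "\<And>x y. x \<in> ball a d \<Longrightarrow> y \<in> ball a d \<Longrightarrow>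
      norm (f x - f y - A (x - y)) \<le> 1 * norm (x - y)"
    using has_strict_derivativeD[OF assms, of 1] by auto
  obtain K where K: "K > 0" "\<And>x. norm (A x) \<le> norm x * K"
    using bounded_linear.pos_bounded[OF has_strict_derivative_bounded_linear[OF assms]] by blast
  have "norm (f x - f y) \<le> (1 + K) * norm (x - y)" if "x \<in> ball a d" "y \<in> ball a d" for x y
  proof -
    have "norm (f x - f y) \<le> norm (f x - f y - A (x - y)) + norm (A (x - y))"
      using norm_triangle_ineq[of "f x - f y - A (x - y)" "A (x - y)"] by simp
    also have "\<dots> \<le> 1 * norm (x - y) + norm (x - y) * K"
      by (intro add_mono d(2) that K(2))
    finally show ?thesis by (simp add: algebra_simps)
  qed
  with \<open>d > 0\<close> \<open>K > 0\<close> show ?thesis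
    by (intro that[of d "1 + K"]) auto
qed

lemma has_strict_derivative_componentwise:
  fixes f A :: "real ^ 'm \<Rightarrow> real ^ 'n"
  assumes "\<And>j. has_strict_derivative (\<lambda>x. f x $ j) (\<lambda>w. A w $ j) a"
  shows "has_strict_derivative f A a"
proof (rule has_strict_derivativeI)
  show "bounded_linear A"
    using assms by (intro bounded_linear_componentwise_iff[THEN iffD2])
      (auto simp: Basis_vec_def inner_axis dest: has_strict_derivative_bounded_linear)
  fix e :: real assume "e > 0"
  define e' where "e' = e / CARD('n)"
  have "e' > 0" using \<open>e > 0\<close> by (simp add: e'_def)
  then have "\<exists>d>0. \<forall>x\<in>ball a d. \<forall>y\<in>ball a d.
      norm (f x $ j - f y $ j - A (x - y) $ j) \<le> e' * norm (x - y)" for j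
    using assms[of j] unfolding has_strict_derivative_def by auto
  then obtain d where d: "\<And>j. d j > 0" "\<And>j x y. x \<in> ball a (d j) \<Longrightarrow> y \<in> ball a (d j) \<Longrightarrow>
      norm (f x $ j - f y $ j - A (x - y) $ j) \<le> e' * norm (x - y)"
    by metis
  show "\<exists>d>0. \<forall>x\<in>ball a d. \<forall>y\<in>ball a d. norm (f x - f y - A (x - y)) \<le> e * norm (x - y)"
  proof (intro exI[of _ "Min (range d)"] conjI ballI)
    show "0 < Min (range d)" using d(1) by (subst Min_gr_iff) auto
    fix x y assume "x \<in> ball a (Min (range d))" "y \<in> ball a (Min (range d))"
    then have xy: "x \<in> ball a (d j)" "y \<in> ball a (d j)" for j
      by (auto simp: Min_gr_iff)
    have "norm (f x - f y - A (x - y)) \<le> (\<Sum>j\<in>UNIV. \<bar>(f x - f y - A (x - y)) $ j\<bar>)"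
      by (rule norm_le_l1_cart)
    also have "\<dots> \<le> (\<Sum>j\<in>(UNIV::'n set). e' * norm (x - y))"
      using d(2)[OF xy] by (intro sum_mono) auto
    also have "\<dots> = e * norm (x - y)"
      by (simp add: e'_def)
    finally show "norm (f x - f y - A (x - y)) \<le> e * norm (x - y)" .
  qed
qed

section \<open>Strict differentiability of power series at their centre\<close>

text \<open>Dividing all coordinates by \<open>s\<close> brings them into [-1,1]. There a difference
  of products is at most the sum of the differences of the factors, and \<open>n\<close>-th powers
  differ by at most \<open>n\<close> times the difference of the bases.\<close>

lemma monomial_diff_bound:
  fixes x y :: "real ^ 'n" and \<alpha> :: "'n \<Rightarrow> nat" and s :: real
  assumes s: "s > 0" and x: "\<And>i. \<bar>x $ i\<bar> \<le> s" and y: "\<And>i. \<bar>y $ i\<bar> \<le> s"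
    and deg: "sum \<alpha> UNIV = Suc m"
  shows "\<bar>(\<Prod>i\<in>UNIV. (x $ i) ^ \<alpha> i) - (\<Prod>i\<in>UNIV. (y $ i) ^ \<alpha> i)\<bar> \<le> Suc m * s ^ m * norm (x - y)"
proof -
  have scale: "(\<Prod>i\<in>UNIV. (z $ i) ^ \<alpha> i) = s ^ Suc m * (\<Prod>i\<in>UNIV. (z $ i / s) ^ \<alpha> i)" for z :: "real ^ 'n"
  proof -
    have "(\<Prod>i\<in>UNIV. (z $ i) ^ \<alpha> i) = (\<Prod>i\<in>UNIV. s ^ \<alpha> i * (z $ i / s) ^ \<alpha> i)"
      using s by (simp flip: power_mult_distrib)
    then show ?thesis
      by (simp add: prod.distrib flip: deg power_sum)
  qed
  have "\<bar>(\<Prod>i\<in>UNIV. (x $ i / s) ^ \<alpha> i) - (\<Prod>i\<in>UNIV. (y $ i / s) ^ \<alpha> i)\<bar>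
      \<le> (\<Sum>i\<in>UNIV. \<bar>(x $ i / s) ^ \<alpha> i - (y $ i / s) ^ \<alpha> i\<bar>)"
    using norm_prod_diff[of UNIV "\<lambda>i. (x $ i / s) ^ \<alpha> i" "\<lambda>i. (y $ i / s) ^ \<alpha> i"] s x y
    by (simp add: power_abs abs_divide power_le_one)
  also have "\<dots> \<le> (\<Sum>i\<in>UNIV. \<alpha> i * (norm (x - y) / s))"
  proof (rule sum_mono)
    fix i
    have "\<bar>(x $ i / s) ^ \<alpha> i - (y $ i / s) ^ \<alpha> i\<bar> \<le> \<alpha> i * \<bar>x $ i / s - y $ i / s\<bar>"
      using norm_power_diff[of "x $ i / s" "y $ i / s" "\<alpha> i"] s x[of i] y[of i] by (simp add: abs_divide)
    also have "\<bar>x $ i / s - y $ i / s\<bar> \<le> norm (x - y) / s"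
      using component_le_norm_cart[of "x - y" i] s
      by (simp add: abs_divide divide_right_mono flip: diff_divide_distrib)
    finally show "\<bar>(x $ i / s) ^ \<alpha> i - (y $ i / s) ^ \<alpha> i\<bar> \<le> \<alpha> i * (norm (x - y) / s)"
      by (simp add: mult_left_mono)
  qed
  also have "\<dots> = Suc m * (norm (x - y) / s)"
    by (simp flip: deg sum_distrib_right sum_divide_distrib)
  finally have "\<bar>(\<Prod>i\<in>UNIV. (x $ i / s) ^ \<alpha> i) - (\<Prod>i\<in>UNIV. (y $ i / s) ^ \<alpha> i)\<bar>
      \<le> Suc m * (norm (x - y) / s)" .
  then have "s ^ Suc m * \<bar>(\<Prod>i\<in>UNIV. (x $ i / s) ^ \<alpha> i) - (\<Prod>i\<in>UNIV. (y $ i / s) ^ \<alpha> i)\<bar>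
      \<le> s ^ Suc m * (Suc m * (norm (x - y) / s))"
    using s by (intro mult_left_mono) auto
  also have "\<dots> = Suc m * s ^ m * norm (x - y)"
    using s by simp
  finally show ?thesis
    unfolding scale[of x] scale[of y] using s
    by (simp only: abs_mult abs_of_pos zero_less_power flip: right_diff_distrib)
qed

text \<open>In \<open>f x - f y\<close> the constant terms cancel and the terms of degree one add up
  to the linear part. On a ball of radius \<open>s\<close>, each remaining term is at most
  \<open>s * norm (x - y)\<close> times a term of a fixed summable family.\<close>

lemma power_series_has_strict_derivative:
  fixes f :: "real ^ 'n \<Rightarrow> real" and c :: "('n \<Rightarrow> nat) \<Rightarrow> real"
  assumes r: "r > 0" and f: "\<And>x. x \<in> ball a r \<Longrightarrow>
      ((\<lambda>\<alpha>. (\<Prod>i\<in>UNIV. (x $ i - a $ i) ^ \<alpha> i) * c \<alpha>) has_sum f x) UNIV"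
  defines "u \<equiv> \<lambda>i j. if j = i then 1 else (0::nat)"
  shows "has_strict_derivative f (\<lambda>w. \<Sum>i\<in>UNIV. w $ i * c (u i)) a"
proof (rule has_strict_derivativeI)
  define A where "A = (\<lambda>w :: real ^ 'n. \<Sum>i\<in>UNIV. w $ i * c (u i))"
  show "bounded_linear A"
    unfolding A_def by (intro bounded_linear_sum bounded_linear_mult_const bounded_linear_vec_nth)
  \<comment> \<open>The vector with all entries \<open>\<rho>\<close> has norm below
    \<open>r\<close>, so the series converges absolutely there. This yields the summable majorant
    \<open>\<rho> ^ sum \<alpha> UNIV * \<bar>c \<alpha>\<bar>\<close>.\<close>
  define \<rho> where "\<rho> = r / (CARD('n) + 1)"
  have \<rho>: "\<rho> > 0" using r by (simp add: \<rho>_def)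
  define p :: "real ^ 'n" where "p = (\<chi> i. \<rho>)"
  have "norm p \<le> (\<Sum>i\<in>UNIV. \<bar>p $ i\<bar>)" by (rule norm_le_l1_cart)
  also have "\<dots> < r" using \<rho> r by (simp add: p_def \<rho>_def field_simps)
  finally have "a + p \<in> ball a r" by (simp add: dist_norm)
  from f[OF this] have "(\<lambda>\<alpha>. \<rho> ^ sum \<alpha> UNIV * c \<alpha>) summable_on UNIV"
    by (auto simp: p_def power_sum summable_on_def)
  then have "(\<lambda>\<alpha>. \<rho> ^ sum \<alpha> UNIV * \<bar>c \<alpha>\<bar>) summable_on UNIV"
    using \<rho> by (simp add: summable_on_iff_abs_summable_on_real[where f = "\<lambda>\<alpha>. \<rho> ^ sum \<alpha> UNIV * c \<alpha>"] abs_mult)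
  then obtain C where C: "((\<lambda>\<alpha>. \<rho> ^ sum \<alpha> UNIV * \<bar>c \<alpha>\<bar>) has_sum C) UNIV"
    by (auto simp: summable_on_def)
  have "C \<ge> 0" using C \<rho> by (intro has_sum_nonneg[OF C]) auto
  fix e :: real assume e: "e > 0"
  \<comment> \<open>The first bound gives powers of 1/2 that absorb the factor \<open>m + 2\<close>,
    at most \<open>2 ^ (m + 2)\<close>, in degree \<open>m + 2\<close>. The second makes the total
    error at most \<open>e\<close>; \<open>C + 1\<close> instead of \<open>C\<close> keeps the
    denominator positive.\<close>
  define s where "s = min (\<rho> / 2) (e * \<rho>\<^sup>2 / (4 * (C + 1)))"
  have s: "s > 0" using \<rho> e \<open>C \<ge> 0\<close> by (simp add: s_def)
  have s1: "s \<le> \<rho> / 2" unfolding s_def by (rule min.cobounded1)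
  have "s \<le> e * \<rho>\<^sup>2 / (4 * (C + 1))" by (simp add: s_def)
  then have s2: "s * 4 * (C + 1) \<le> e * \<rho>\<^sup>2" using \<open>C \<ge> 0\<close> by (simp add: field_simps)
  \<comment> \<open>\<open>H\<close> collects the multi-indices of degree 0 and 1, that is, zero and
    the unit indices \<open>u i\<close>. Removing them from the series leaves exactly the error
    term.\<close>
  define H where "H = {\<alpha>::'n \<Rightarrow> nat. sum \<alpha> UNIV \<le> 1}"
  have H: "H = insert (\<lambda>_. 0) (range u)"
  proof safe
    fix \<alpha> assume "\<alpha> \<in> H" "\<alpha> \<notin> range u"
    show "\<alpha> = (\<lambda>_. 0)"
    proof (rule ccontr)
      assume "\<alpha> \<noteq> (\<lambda>_. 0)"
      then obtain i where i: "\<alpha> i \<noteq> 0" by auto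
      have "\<alpha> i + sum \<alpha> (UNIV - {i}) \<le> 1"
        using \<open>\<alpha> \<in> H\<close> by (simp add: H_def flip: sum.remove)
      with i have "\<alpha> i = 1" "sum \<alpha> (UNIV - {i}) = 0" by linarith+
      then have "\<alpha> = u i" by (auto simp: u_def)
      with \<open>\<alpha> \<notin> range u\<close> show False by auto
    qed
  qed (auto simp: H_def u_def)
  have [simp]: "finite H" by (simp add: H)
  have "inj u" by (auto simp: inj_def u_def fun_eq_iff split: if_splits)
  have u0: "(\<lambda>_. 0) \<notin> range u"
    by (metis (full_types) imageE u_def zero_neq_one)
  have bound: "norm (f x - f y - A (x - y)) \<le> e * norm (x - y)"
    if x: "x \<in> ball a s" and y: "y \<in> ball a s" for x y
  proof -
    define T where "T = (\<lambda>\<alpha>. ((\<Prod>i\<in>UNIV. (x $ i - a $ i) ^ \<alpha> i) - (\<Prod>i\<in>UNIV. (y $ i - a $ i) ^ \<alpha> i)) * c \<alpha>)"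
    have "\<rho> \<le> r" using r by (simp add: \<rho>_def field_simps)
    then have "ball a s \<subseteq> ball a r" using s1 \<rho> by (intro subset_ball) auto
    then have fx: "((\<lambda>\<alpha>. (\<Prod>i\<in>UNIV. (z $ i - a $ i) ^ \<alpha> i) * c \<alpha>) has_sum f z) UNIV"
      if "z \<in> ball a s" for z
      using that by (intro f) auto
    have "((\<lambda>\<alpha>. - ((\<Prod>i\<in>UNIV. (y $ i - a $ i) ^ \<alpha> i) * c \<alpha>)) has_sum - f y) UNIV"
      using fx[OF y] by (subst has_sum_uminus) simp
    from has_sum_add[OF fx[OF x] this] have "(T has_sum (f x - f y)) UNIV"
      by (simp add: T_def left_diff_distrib)
    moreover have "(T has_sum sum T H) H" by simp
    ultimately have "(T has_sum (f x - f y - sum T H)) (UNIV - H)"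
      by (rule has_sum_Diff) auto
    moreover have "sum T H = A (x - y)"
    proof -
      have "sum T H = T (\<lambda>_. 0) + (\<Sum>i\<in>UNIV. T (u i))"
        unfolding H using u0 by (simp add: sum.reindex[OF \<open>inj u\<close>])
      moreover have "(\<Prod>j\<in>UNIV. z j ^ u i j) = z i" for z :: "'n \<Rightarrow> real" and i
        unfolding u_def by (simp add: if_distrib[of "\<lambda>n. z _ ^ n"] prod.delta' cong: if_cong)
      ultimately show ?thesis
        by (simp add: T_def A_def)
    qed
    ultimately have T: "(T has_sum (f x - f y - A (x - y))) (UNIV - H)" by simp
    obtain C' where C': "((\<lambda>\<alpha>. \<rho> ^ sum \<alpha> UNIV * \<bar>c \<alpha>\<bar>) has_sum C') (UNIV - H)" "C' \<le> C"
    proof -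
      have "(\<lambda>\<alpha>. \<rho> ^ sum \<alpha> UNIV * \<bar>c \<alpha>\<bar>) summable_on (UNIV - H)"
        by (rule summable_on_subset_banach[OF has_sum_imp_summable[OF C]]) auto
      then obtain C' where C': "((\<lambda>\<alpha>. \<rho> ^ sum \<alpha> UNIV * \<bar>c \<alpha>\<bar>) has_sum C') (UNIV - H)"
        by (auto simp: summable_on_def)
      moreover have "C' \<le> C" using \<rho> by (intro has_sum_mono2[OF C' C]) auto
      ultimately show ?thesis by (rule that)
    qed
    have C'2: "((\<lambda>\<alpha>. s * 4 / \<rho>\<^sup>2 * norm (x - y) * (\<rho> ^ sum \<alpha> UNIV * \<bar>c \<alpha>\<bar>)) has_sum (s * 4 / \<rho>\<^sup>2 * norm (x - y) * C')) (UNIV - H)"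
      by (intro has_sum_cmult_right C')
    have T_le: "norm (T \<alpha>) \<le> s * 4 / \<rho>\<^sup>2 * norm (x - y) * (\<rho> ^ sum \<alpha> UNIV * \<bar>c \<alpha>\<bar>)"
      if "\<alpha> \<in> UNIV - H" for \<alpha>
    proof -
      have "2 \<le> sum \<alpha> UNIV" using that by (auto simp: H_def)
      then obtain m where m: "sum \<alpha> UNIV = Suc (Suc m)" by (metis One_nat_def Suc_1 Suc_le_D Suc_le_mono)
      have ax: "\<bar>(x - a) $ i\<bar> \<le> s" "\<bar>(y - a) $ i\<bar> \<le> s" for i
        using component_le_norm_cart[of "x - a" i] component_le_norm_cart[of "y - a" i] x y
        by (auto simp: dist_norm norm_minus_commute)
      have "norm (T \<alpha>) \<le> (Suc (Suc m) * s ^ Suc m * norm (x - y)) * \<bar>c \<alpha>\<bar>"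
        using monomial_diff_bound[OF s ax m] by (simp add: T_def abs_mult mult_right_mono)
      moreover have "Suc (Suc m) * s ^ Suc m \<le> s * 4 / \<rho>\<^sup>2 * \<rho> ^ sum \<alpha> UNIV"
      proof -
        have "real (Suc (Suc m)) \<le> 2 ^ Suc (Suc m)"
          by (metis of_nat_less_two_power less_imp_le)
        then have "real (Suc (Suc m)) * s ^ Suc m \<le> 2 ^ Suc (Suc m) * (s * (\<rho> / 2) ^ m)"
          using s s1 by (intro mult_mono) (auto intro: power_mono)
        also have "\<dots> = s * 4 / \<rho>\<^sup>2 * \<rho> ^ sum \<alpha> UNIV"
          using \<rho> by (simp add: m field_simps power2_eq_square)
        finally show ?thesis .
      qed
      then have "Suc (Suc m) * s ^ Suc m * (norm (x - y) * \<bar>c \<alpha>\<bar>)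
          \<le> s * 4 / \<rho>\<^sup>2 * \<rho> ^ sum \<alpha> UNIV * (norm (x - y) * \<bar>c \<alpha>\<bar>)"
        by (rule mult_right_mono) simp
      ultimately show ?thesis by (simp only: mult_ac)
    qed
    have "norm (f x - f y - A (x - y)) \<le> s * 4 / \<rho>\<^sup>2 * norm (x - y) * C'"
      using T C'2 T_le by (rule norm_infsum_le)
    also have "\<dots> \<le> e * norm (x - y)"
    proof -
      have "s * 4 * C' \<le> s * 4 * (C + 1)" using C' s by (intro mult_left_mono) auto
      also note s2
      finally have "s * 4 / \<rho>\<^sup>2 * C' \<le> e" using \<rho> by (simp add: field_simps)
      then have "s * 4 / \<rho>\<^sup>2 * C' * norm (x - y) \<le> e * norm (x - y)" by (intro mult_right_mono) auto
      then show ?thesis by (simp add: mult_ac)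
    qed
    finally show ?thesis .
  qed
  then show "\<exists>d>0. \<forall>x\<in>ball a d. \<forall>y\<in>ball a d. norm (f x - f y - A (x - y)) \<le> e * norm (x - y)"
    using s by blast
qed

lemma real_analytic_at_imp_has_strict_derivative:
  fixes f :: "real ^ 'n \<Rightarrow> real ^ 'm"
  assumes "real_analytic_at f a"
  obtains A where "has_strict_derivative f A a"
proof -
  obtain r c where r: "r > 0" and c: "\<And>x. x \<in> ball a r \<Longrightarrow>
      ((\<lambda>\<alpha>. (\<Prod>i\<in>UNIV. (x $ i - a $ i) ^ \<alpha> i) *\<^sub>R c \<alpha>) has_sum f x) UNIV"
    using assms unfolding real_analytic_at_def by blast
  have "((\<lambda>\<alpha>. (\<Prod>i\<in>UNIV. (x $ i - a $ i) ^ \<alpha> i) * c \<alpha> $ j) has_sum f x $ j) UNIV"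
    if "x \<in> ball a r" for x j
    using has_sum_bounded_linear[OF bounded_linear_vec_nth c[OF that], of j] by simp
  from power_series_has_strict_derivative[OF r this]
  show ?thesis
    by (intro that[of "\<lambda>w. \<chi> j. \<Sum>i\<in>UNIV. w $ i * c (\<lambda>k. if k = i then 1 else 0) $ j"]
        has_strict_derivative_componentwise) simp
qed

section \<open>The integral of the Jacobian determinant\<close>

lemma det_pencil_poly:
  fixes A B :: "real ^ 'n ^ 'n"
  obtains p where "degree p \<le> CARD('n)" "\<And>t. det (A + t *\<^sub>R B) = poly p t"
proof
  define p where "p = (\<Sum>\<pi>\<in>{\<pi>. \<pi> permutes (UNIV::'n set)}.
      smult (of_int (sign \<pi>)) (\<Prod>i\<in>UNIV. [:A $ i $ \<pi> i, B $ i $ \<pi> i:]))"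
  have "degree (smult (of_int (sign \<pi>)) (\<Prod>i\<in>UNIV. [:A $ i $ \<pi> i, B $ i $ \<pi> i:])) \<le> CARD('n)"
    for \<pi> :: "'n \<Rightarrow> 'n"
  proof -
    have "degree (\<Prod>i\<in>UNIV. [:A $ i $ \<pi> i, B $ i $ \<pi> i:])
        \<le> (\<Sum>i\<in>UNIV. degree [:A $ i $ \<pi> i, B $ i $ \<pi> i:])"
      using degree_prod_sum_le[of UNIV "\<lambda>i. [:A $ i $ \<pi> i, B $ i $ \<pi> i:]"] by (simp add: o_def)
    also have "\<dots> \<le> (\<Sum>i\<in>(UNIV::'n set). 1)" by (intro sum_mono) auto
    finally show ?thesis
      by (intro order_trans[OF degree_smult_le]) simp
  qed
  then show "degree p \<le> CARD('n)"
    unfolding p_def by (intro degree_sum_le finite_permutations) auto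
  show "det (A + t *\<^sub>R B) = poly p t" for t
    by (simp add: det_def p_def poly_sum poly_prod)
qed

text \<open>No matrix on the segment from \<open>A\<close> to \<open>B\<close> has a kernel: a
  kernel vector \<open>w\<close> would give
  \<open>norm (A *v w) \<le> norm (B *v w - A *v w)\<close>. So the determinant, a polynomial in the
  segment parameter, has no root on [0,1] and keeps its sign.\<close>

lemma det_mult_pos:
  fixes A B :: "real ^ 'n ^ 'n"
  assumes "\<And>w. w \<noteq> 0 \<Longrightarrow> norm (B *v w - A *v w) < norm (A *v w)"
  shows "det A * det B > 0"
proof -
  obtain p where p: "\<And>t. det (A + t *\<^sub>R (B - A)) = poly p t"
    using det_pencil_poly[of A "B - A"] by blast
  have nz: "poly p t \<noteq> 0" if "0 \<le> t" "t \<le> 1" for t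
  proof -
    have "w = 0" if "(A + t *\<^sub>R (B - A)) *v w = 0" for w
    proof (rule ccontr)
      assume "w \<noteq> 0"
      have "A *v w = - (t *\<^sub>R (B *v w - A *v w))"
        using that by (simp add: matrix_vector_mult_add_rdistrib matrix_vector_mult_diff_rdistrib
            eq_neg_iff_add_eq_0 flip: scaleR_matrix_vector_assoc)
      then have "norm (A *v w) = norm (t *\<^sub>R (B *v w - A *v w))"
        by (metis norm_minus_cancel)
      also have "\<dots> = t * norm (B *v w - A *v w)"
        using \<open>0 \<le> t\<close> by simp
      also have "\<dots> \<le> 1 * norm (B *v w - A *v w)"
        using \<open>t \<le> 1\<close> by (intro mult_right_mono) auto
      finally show False using assms[OF \<open>w \<noteq> 0\<close>] by simp
    qed
    then have "invertible (A + t *\<^sub>R (B - A))"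
      by (simp add: invertible_left_inverse matrix_left_invertible_ker)
    then show ?thesis by (simp add: invertible_det_nz p)
  qed
  have "det A = poly p 0" "det B = poly p 1" using p[of 0] p[of 1] by simp_all
  moreover have "\<not> poly p 0 * poly p 1 < 0"
    using poly_IVT[of 0 1 p] nz by (metis less_imp_le zero_less_one)
  ultimately show ?thesis using nz[of 0] nz[of 1]
    by (simp add: not_less less_le)
qed

text \<open>Lagrange interpolation at \<open>n + 1\<close> nodes below \<open>\<tau>\<close>,
  evaluated at 1. The weights do not depend on the polynomial, so identities between integrals at
  small parameters pass to the parameter 1 by linearity.\<close>

lemma poly_interpolation_at_1:
  fixes \<tau> :: real
  assumes "\<tau> > 0"
  obtains t \<Lambda> :: "nat \<Rightarrow> real" where
    "\<And>k. 0 < t k" "\<And>k. t k < \<tau>"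
    "\<And>p. degree p \<le> n \<Longrightarrow> poly p 1 = (\<Sum>k\<le>n. \<Lambda> k * poly p (t k))"
proof -
  \<comment> \<open>The shift by 2, rather than 1, keeps even the node for \<open>k = 0\<close>
    strictly below \<open>\<tau>\<close>.\<close>
  define t where "t k = \<tau> / (real k + 2)" for k
  have t: "0 < t k" "t k < \<tau>" for k
    using assms by (auto simp: t_def field_simps intro: add_pos_nonneg)
  have inj: "t j = t k \<longleftrightarrow> j = k" for j k using assms by (simp add: t_def field_simps)
  \<comment> \<open>These are the Lagrange basis polynomials of the nodes \<open>t 0\<close>, ...,
    \<open>t n\<close>.\<close>
  define l where "l k = smult (1 / (\<Prod>j\<in>{..n}-{k}. t k - t j)) (\<Prod>j\<in>{..n}-{k}. [:- t j, 1:])" for k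
  have deg: "degree (l k) \<le> n" if "k \<le> n" for k
  proof -
    have "degree (\<Prod>j\<in>{..n}-{k}. [:- t j, 1:]) \<le> (\<Sum>j\<in>{..n}-{k}. degree [:- t j, 1:])"
      using degree_prod_sum_le[of "{..n}-{k}" "\<lambda>j. [:- t j, 1:]"] by (simp add: o_def)
    then show ?thesis
      using that unfolding l_def by (intro order_trans[OF degree_smult_le]) simp
  qed
  have val: "poly (l k) (t j) = (if j = k then 1 else 0)" if "j \<le> n" for j k
    using that by (auto simp: l_def poly_prod inj prod_zero_iff)
  show thesis
  proof (rule that[of t "\<lambda>k. poly (l k) 1"])
    fix p :: "real poly" assume p: "degree p \<le> n"
    have "p = (\<Sum>k\<le>n. smult (poly p (t k)) (l k))"
    proof (rule poly_eqI_degree)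
      have "inj_on t {..n}" by (simp add: inj_on_def inj)
      then have card: "card (t ` {..n}) = Suc n" by (simp add: card_image)
      then show "degree p < card (t ` {..n})" using p by simp
      have "degree (\<Sum>k\<le>n. smult (poly p (t k)) (l k)) \<le> n"
        using deg by (intro degree_sum_le) (auto intro: order_trans[OF degree_smult_le])
      then show "degree (\<Sum>k\<le>n. smult (poly p (t k)) (l k)) < card (t ` {..n})"
        using card by simp
      show "poly p x = poly (\<Sum>k\<le>n. smult (poly p (t k)) (l k)) x" if "x \<in> t ` {..n}" for x
        using that by (auto simp: poly_sum val if_distrib[of "\<lambda>x. _ * x"] cong: if_cong)
    qed
    then have "poly p 1 = poly (\<Sum>k\<le>n. smult (poly p (t k)) (l k)) 1" by simp
    then show "poly p 1 = (\<Sum>k\<le>n. poly (l k) 1 * poly p (t k))"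
      by (simp add: poly_sum mult.commute)
  qed (use t in auto)
qed

section \<open>Almost everywhere differentiable Lipschitz maps and change of variables\<close>

text \<open>Evaluate along the ray \<open>x + s *\<^sub>R w\<close>, divide by \<open>s\<close>, and
  let the error of \<open>D\<close> tend to 0. Taking \<open>A\<close> to be zero turns a Lipschitz
  bound into a bound on the derivative; a strict derivative as \<open>A\<close> shows that
  derivatives at nearby points are close to it.\<close>

lemma norm_derivative_diff_le:
  assumes f: "(f has_derivative D) (at x)" and A: "linear A" and "d > 0"
    and le: "\<And>y. y \<in> ball x d \<Longrightarrow> norm (f y - f x - A (y - x)) \<le> e * norm (y - x)"
  shows "norm (D w - A w) \<le> e * norm w"
proof (cases "w = 0")
  case True
  then show ?thesis
    using f A by (simp add: linear_0 bounded_linear.linear has_derivative_bounded_linear)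
next
  case False
  have D: "linear D" using f by (simp add: bounded_linear.linear has_derivative_bounded_linear)
  show ?thesis
  proof (rule field_le_epsilon)
    fix \<eta> :: real assume "\<eta> > 0"
    then have "\<eta> / norm w > 0" using False by simp
    then obtain d' where "d' > 0" and d': "\<And>y. norm (y - x) < d' \<Longrightarrow>
        norm (f y - f x - D (y - x)) \<le> \<eta> / norm w * norm (y - x)"
      using f unfolding has_derivative_at_alt by blast
    define s where "s = min d d' / (2 * norm w)"
    have s: "s > 0" "s * norm w < d" "s * norm w < d'"
      using \<open>d > 0\<close> \<open>d' > 0\<close> False by (auto simp: s_def)
    define y where "y = x + s *\<^sub>R w"
    have y: "y - x = s *\<^sub>R w" "norm (y - x) = s * norm w" using s by (auto simp: y_def)
    have "y \<in> ball x d" using s(2) y(2) by (simp add: dist_norm norm_minus_commute)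
    have "s * norm (D w - A w) = norm ((f y - f x - A (y - x)) - (f y - f x - D (y - x)))"
      using s unfolding y(1) linear_scale[OF A] linear_scale[OF D]
      by (simp flip: scaleR_diff_right)
    also have "\<dots> \<le> norm (f y - f x - A (y - x)) + norm (f y - f x - D (y - x))"
      by (rule norm_triangle_ineq4)
    also have "\<dots> \<le> e * norm (y - x) + \<eta> / norm w * norm (y - x)"
      using le[OF \<open>y \<in> ball x d\<close>] d'[of y] s y by (intro add_mono) auto
    also have "\<dots> = s * (e * norm w + \<eta>)"
      using False by (simp add: y(2) field_simps)
    finally show "norm (D w - A w) \<le> e * norm w + \<eta>"
      using s by simp
  qed
qed

lemma matrix_mult_has_derivative:
  fixes f :: "real ^ 'n \<Rightarrow> real ^ 'm"
  assumes "(f has_derivative D) F"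
  shows "matrix D *v w = D w"
  using assms by (simp add: matrix_works bounded_linear.linear has_derivative_bounded_linear
      linear_conv_bounded_linear)

lemma negligible_Lipschitz_image:
  fixes f :: "'a::euclidean_space \<Rightarrow> 'b::euclidean_space"
  assumes "DIM('a) \<le> DIM('b)" "negligible N"
    and "\<And>x y. x \<in> N \<Longrightarrow> y \<in> N \<Longrightarrow> norm (f x - f y) \<le> L * norm (x - y)"
  shows "negligible (f ` N)"
  using assms by (intro negligible_locally_Lipschitz_image) (auto intro!: exI[of _ UNIV] exI[of _ L])

text \<open>This is the change of variables formula on \<open>S - N\<close>. Being Lipschitz,
  \<open>f\<close> maps the part of \<open>N\<close> inside \<open>S\<close> to a null set, so the
  image of \<open>S - N\<close> still has the measure of \<open>T\<close>.\<close>

lemma has_integral_abs_det_Lipschitz_bij: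
  fixes f :: "real ^ 'n::{finite,wellorder} \<Rightarrow> real ^ 'n::_"
  assumes S: "open S" and T: "T \<in> lmeasurable" and bij: "bij_betw f S T"
    and lip: "\<And>x y. x \<in> S \<Longrightarrow> y \<in> S \<Longrightarrow> norm (f x - f y) \<le> L * norm (x - y)"
    and N: "negligible N" and der: "\<And>x. x \<in> S - N \<Longrightarrow> (f has_derivative f' x) (at x)"
  shows "((\<lambda>x. \<bar>det (matrix (f' x))\<bar>) has_integral measure lebesgue T) (S - N)"
proof -
  have inj: "inj_on f S" and img: "f ` S = T" using bij by (auto simp: bij_betw_def)
  have "negligible (f ` (S \<inter> N))"
    using N lip by (intro negligible_Lipschitz_image[where L = L]) (auto intro: negligible_subset)
  then have null: "f ` (S \<inter> N) \<in> null_sets lebesgue" by (simp add: negligible_iff_null_sets)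
  have eq: "f ` (S - N) = T - f ` (S \<inter> N)"
    using inj img by (auto simp: inj_on_def)
  have "f ` (S - N) \<in> lmeasurable"
    unfolding eq using T null by (intro fmeasurable_Diff) (auto dest: null_setsD2)
  moreover have "measure lebesgue (f ` (S - N)) = measure lebesgue T"
    unfolding eq using null T by (intro measure_Diff_null_set) (auto simp: fmeasurableD)
  moreover have "S - N \<in> sets lebesgue"
    using S N by (intro sets.Diff) (auto simp: negligible_iff_null_sets null_setsD2)
  moreover have "inj_on f (S - N)" using inj by (rule inj_on_subset) auto
  ultimately show ?thesis
    using has_measure_differentiable_image[of "S - N" f f' "measure lebesgue T"] der
    by (blast intro: has_derivative_at_withinI)
qed

lemma matrix_pencil:
  "matrix (\<lambda>w. w + t *\<^sub>R (D w - w)) = mat 1 + t *\<^sub>R (matrix D - mat 1)"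
  by (auto simp: matrix_def mat_def axis_def vec_eq_iff)

lemma has_integral_det_Jacobian_ball:
  fixes f :: "real ^ 'n::{finite,wellorder} \<Rightarrow> real ^ 'n::_"
  assumes lip: "\<And>x y. norm (f x - f y) \<le> L * norm (x - y)"
    and id: "\<And>x. R \<le> norm x \<Longrightarrow> f x = x"
    and N: "negligible N" and der: "\<And>x. x \<notin> N \<Longrightarrow> (f has_derivative f' x) (at x)"
  shows "((\<lambda>x. det (matrix (f' x))) has_integral measure lebesgue (ball 0 R :: (real ^ 'n::_) set))
    (ball 0 R - N)"
proof -
  define h where "h x = f x - x" for x
  define K where "K = \<bar>L\<bar> + 1"
  have K: "K > 0" by (simp add: K_def)
  have h: "norm (h x - h y) \<le> K * norm (x - y)" for x y
  proof -
    have "norm (h x - h y) = norm ((f x - f y) - (x - y))" by (simp add: h_def algebra_simps)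
    also have "\<dots> \<le> L * norm (x - y) + norm (x - y)"
      using norm_triangle_ineq4 lip by (metis add_mono_thms_linordered_semiring(3) order_trans)
    also have "\<dots> \<le> K * norm (x - y)"
      unfolding K_def by (simp add: algebra_simps mult_right_mono)
    finally show ?thesis .
  qed
  have h': "norm (f' x w - w) \<le> K * norm w" if "x \<notin> N" for x w
  proof -
    have "(h has_derivative (\<lambda>w. f' x w - w)) (at x)"
      unfolding h_def by (intro derivative_intros der that)
    \<comment> \<open>The comparison map is zero, so the Lipschitz constant of \<open>h\<close>
      bounds its derivative.\<close>
    from norm_derivative_diff_le[OF this module_hom_zero zero_less_one, of K]
    show ?thesis using h by simp
  qed
  let ?B = "ball 0 R :: (real ^ 'n::_) set"
  have small: "((\<lambda>x. det (mat 1 + t *\<^sub>R (matrix (f' x) - mat 1))) has_integral measure lebesgue ?B) (?B - N)"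
    if t: "0 < t" "t < 1 / K" for t
  proof -
    have tK: "t * K < 1" using t K by (simp add: field_simps)
    define ft where "ft x = x + t *\<^sub>R h x" for x
    have th: "norm (t *\<^sub>R h x - t *\<^sub>R h y) \<le> t * K * norm (x - y)" for x y
    proof -
      have "norm (t *\<^sub>R h x - t *\<^sub>R h y) = t * norm (h x - h y)"
        using t by (simp flip: scaleR_diff_right)
      then show ?thesis using h[of x y] t by (simp add: mult.assoc)
    qed
    \<comment> \<open>Since \<open>t *\<^sub>R h\<close> is a contraction, \<open>ft\<close> is a
      contractive perturbation of the identity: injective by the triangle inequality, surjective by
      Banach's fixed point theorem.\<close>
    have inj: "x = y" if "ft x = ft y" for x y
    proof -
      have "x = y + t *\<^sub>R h y - t *\<^sub>R h x" using that by (simp add: ft_def eq_diff_eq)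
      then have "x - y = t *\<^sub>R h y - t *\<^sub>R h x" by (metis add_diff_cancel_left' add_diff_eq)
      then have "norm (x - y) = norm (t *\<^sub>R h y - t *\<^sub>R h x)" by simp
      also have "\<dots> \<le> t * K * norm (x - y)" using th[of y x] by (simp add: norm_minus_commute)
      finally have "(1 - t * K) * norm (x - y) \<le> 0" by (simp add: algebra_simps)
      with tK show ?thesis by (simp add: mult_le_0_iff)
    qed
    have surj: "\<exists>x. ft x = y" for y
    proof -
      have "\<exists>!x. y - t *\<^sub>R h x = x"
      proof (rule banach_fix_type)
        show "0 \<le> t * K" "t * K < 1" using t K tK by auto
        show "\<forall>x z. dist (y - t *\<^sub>R h x) (y - t *\<^sub>R h z) \<le> t * K * dist x z"
          using th by (simp add: dist_norm norm_minus_commute)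
      qed
      then show ?thesis by (metis ft_def diff_add_cancel)
    qed
    have ft_id: "ft x = x" if "R \<le> norm x" for x using that by (simp add: ft_def h_def id)
    have "bij_betw ft ?B ?B"
      unfolding bij_betw_def
    proof (intro conjI set_eqI iffI)
      show "inj_on ft ?B" using inj by (auto simp: inj_on_def)
      \<comment> \<open>Points outside the ball are fixed, so by injectivity they cannot also be
        values at points inside. Dually, a preimage of a point of the ball cannot lie
        outside.\<close>
      show "y \<in> ?B" if y: "y \<in> ft ` ?B" for y
      proof (rule ccontr)
        assume "y \<notin> ?B"
        then have "ft y = y" by (intro ft_id) simp
        obtain x where "x \<in> ?B" "y = ft x" using y by (rule imageE)
        then have "y = x" using inj[of y x] \<open>ft y = y\<close> by simp
        with \<open>x \<in> ?B\<close> \<open>y \<notin> ?B\<close> show False by simp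
      qed
      show "y \<in> ft ` ?B" if "y \<in> ?B" for y
      proof -
        obtain x where "ft x = y" using surj by blast
        then show ?thesis using that ft_id[of x] by (cases "R \<le> norm x") auto
      qed
    qed
    moreover have "norm (ft x - ft y) \<le> (1 + t * K) * norm (x - y)" for x y
    proof -
      have "norm (ft x - ft y) = norm ((x - y) + (t *\<^sub>R h x - t *\<^sub>R h y))"
        by (simp add: ft_def algebra_simps)
      also have "\<dots> \<le> norm (x - y) + t * K * norm (x - y)"
        using norm_triangle_ineq th by (metis add_left_mono order_trans)
      finally show ?thesis by (simp add: algebra_simps)
    qed
    moreover have "(ft has_derivative (\<lambda>w. w + t *\<^sub>R (f' x w - w))) (at x)" if "x \<in> ?B - N" for x
      unfolding ft_def h_def using that by (auto intro!: derivative_eq_intros der)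
    ultimately have "((\<lambda>x. \<bar>det (matrix (\<lambda>w. w + t *\<^sub>R (f' x w - w)))\<bar>) has_integral measure lebesgue ?B) (?B - N)"
      by (intro has_integral_abs_det_Lipschitz_bij[where f = ft and L = "1 + t * K"] N) auto
    then show ?thesis
    proof (rule has_integral_eq[rotated])
      fix x assume x: "x \<in> ?B - N"
      have "norm ((mat 1 + t *\<^sub>R (matrix (f' x) - mat 1)) *v w - mat 1 *v w) < norm (mat 1 *v w)" if "w \<noteq> 0" for w
      proof -
        have "(mat 1 + t *\<^sub>R (matrix (f' x) - mat 1)) *v w - mat 1 *v w = t *\<^sub>R (f' x w - w)"
          using matrix_mult_has_derivative[OF der, of x w] x
          by (simp add: matrix_vector_mult_add_rdistrib matrix_vector_mult_diff_rdistrib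
              flip: scaleR_matrix_vector_assoc)
        then have "norm ((mat 1 + t *\<^sub>R (matrix (f' x) - mat 1)) *v w - mat 1 *v w) \<le> t * (K * norm w)"
          using h'[of x w] x t by simp
        also have "\<dots> < 1 * norm w" using tK that by (simp flip: mult.assoc)
        finally show ?thesis by simp
      qed
      from det_mult_pos[OF this]
      show "\<bar>det (matrix (\<lambda>w. w + t *\<^sub>R (f' x w - w)))\<bar> = det (mat 1 + t *\<^sub>R (matrix (f' x) - mat 1))"
        by (simp add: matrix_pencil)
    qed
  qed
  obtain t \<Lambda> :: "nat \<Rightarrow> real" where t: "\<And>k. 0 < t k" "\<And>k. t k < 1 / K"
    and interp: "\<And>p. degree p \<le> CARD('n) \<Longrightarrow> poly p 1 = (\<Sum>k\<le>CARD('n). \<Lambda> k * poly p (t k))"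
    using poly_interpolation_at_1[of "1 / K"] K by (metis zero_less_divide_1_iff)
  have "((\<lambda>x. \<Sum>k\<le>CARD('n). \<Lambda> k * det (mat 1 + t k *\<^sub>R (matrix (f' x) - mat 1)))
      has_integral (\<Sum>k\<le>CARD('n). \<Lambda> k * measure lebesgue ?B)) (?B - N)"
    by (intro has_integral_sum has_integral_mult_right small t) auto
  \<comment> \<open>Interpolating the constant polynomial 1 shows that the weights sum to 1.\<close>
  moreover have "(\<Sum>k\<le>CARD('n). \<Lambda> k * measure lebesgue ?B) = measure lebesgue ?B"
    using interp[of 1] by (simp flip: sum_distrib_right)
  moreover have "(\<Sum>k\<le>CARD('n). \<Lambda> k * det (mat 1 + t k *\<^sub>R (matrix (f' x) - mat 1))) = det (matrix (f' x))" for x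
  proof -
    obtain p where p: "degree p \<le> CARD('n)" "\<And>t. det (mat 1 + t *\<^sub>R (matrix (f' x) - mat 1)) = poly p t"
      using det_pencil_poly by blast
    then show ?thesis using interp[OF p(1)] p(2)[of 1] by simp
  qed
  ultimately show ?thesis by simp
qed

section \<open>Parity of the number of zeros\<close>

lemma closest_point_cball_0:
  fixes x :: "'a::euclidean_space"
  assumes "0 \<le> r" "r \<le> norm x"
  shows "closest_point (cball 0 r) x = (r / norm x) *\<^sub>R x"
proof (rule sym, rule closest_point_unique)
  show "\<forall>z\<in>cball 0 r. dist x ((r / norm x) *\<^sub>R x) \<le> dist x z"
  proof
    fix z :: 'a assume z: "z \<in> cball 0 r"
    have "dist x ((r / norm x) *\<^sub>R x) = norm ((1 - r / norm x) *\<^sub>R x)"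
      by (simp add: dist_norm algebra_simps)
    also have "\<dots> = norm x - r"
      using assms by (cases "x = 0") (auto simp: field_simps abs_if)
    also have "\<dots> \<le> norm (x - z)"
      using z norm_triangle_ineq2[of x z] by simp
    finally show "dist x ((r / norm x) *\<^sub>R x) \<le> dist x z" by (simp add: dist_norm)
  qed
qed (use assms in \<open>auto simp: divide_le_eq_1\<close>)

text \<open>Let \<open>B\<close> be a lower bound for \<open>A\<close> and allow a strict derivative
  error of \<open>B / 2\<close>. Then \<open>g\<close> keeps the lower bound \<open>B / 2\<close>
  near \<open>a\<close>, and every derivative of \<open>g\<close> there is close enough to
  \<open>A\<close> for its determinant to have the same sign. Writing this as \<open>s\<close> times
  the absolute value lets the signs leave the integral.\<close>

lemma has_strict_derivative_inj_nhds:
  fixes g :: "real ^ 'n \<Rightarrow> real ^ 'n"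
  assumes g: "has_strict_derivative g A a" and "inj A"
  obtains d c s where "d > 0" "c > 0" "s = 1 \<or> s = (-1 :: real)"
    "\<And>x y. x \<in> ball a d \<Longrightarrow> y \<in> ball a d \<Longrightarrow> c * norm (x - y) \<le> norm (g x - g y)"
    "\<And>x D. x \<in> ball a d \<Longrightarrow> (g has_derivative D) (at x) \<Longrightarrow> det (matrix D) = s * \<bar>det (matrix D)\<bar>"
proof -
  have A: "linear A"
    using has_strict_derivative_bounded_linear[OF g] by (rule bounded_linear.linear)
  obtain B where B: "B > 0" "\<And>w. B * norm w \<le> norm (A w)"
    using linear_inj_bounded_below_pos[OF A \<open>inj A\<close>] by blast
  obtain d where "d > 0" and d: "\<And>x y. x \<in> ball a d \<Longrightarrow> y \<in> ball a d \<Longrightarrow>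
      norm (g x - g y - A (x - y)) \<le> B / 2 * norm (x - y)"
    using has_strict_derivativeD[OF g, of "B / 2"] B by auto
  have below: "B / 2 * norm (x - y) \<le> norm (g x - g y)" if "x \<in> ball a d" "y \<in> ball a d" for x y
  proof -
    have "norm (A (x - y)) \<le> norm (g x - g y) + norm (g x - g y - A (x - y))"
      using norm_triangle_ineq4[of "g x - g y" "g x - g y - A (x - y)"] by simp
    with d[OF that] B(2)[of "x - y"] show ?thesis by (simp add: field_simps)
  qed
  have det: "det (matrix A) * det (matrix D) > 0" if x: "x \<in> ball a d" and D: "(g has_derivative D) (at x)" for x D
  proof (rule det_mult_pos)
    fix w :: "real ^ 'n" assume "w \<noteq> 0"
    have "norm (D w - A w) \<le> B / 2 * norm w"
    proof (rule norm_derivative_diff_le[OF D A])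
      show "0 < d - dist a x" using x by simp
      fix y assume "y \<in> ball x (d - dist a x)"
      then have "y \<in> ball a d" by (simp, metric)
      with x show "norm (g y - g x - A (y - x)) \<le> B / 2 * norm (y - x)" by (intro d)
    qed
    also have "\<dots> < B * norm w" using B \<open>w \<noteq> 0\<close> by simp
    also have "\<dots> \<le> norm (A w)" by (rule B)
    finally show "norm (matrix D *v w - matrix A *v w) < norm (matrix A *v w)"
      using A by (simp add: matrix_mult_has_derivative[OF D] matrix_works linear_conv_bounded_linear
          linear_matrix_vector_mul_eq)
  qed
  have "det (matrix D) = sgn (det (matrix A)) * \<bar>det (matrix D)\<bar>"
    if "x \<in> ball a d" "(g has_derivative D) (at x)" for x D
    using det[OF that] by (auto simp: sgn_if zero_less_mult_iff abs_if)
  moreover have "sgn (det (matrix A)) = 1 \<or> sgn (det (matrix A)) = -1"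
    using det[of a A] \<open>d > 0\<close> has_strict_derivative_imp_has_derivative[OF g]
    by (auto simp: sgn_if)
  ultimately show thesis
    using \<open>d > 0\<close> B(1) below by (intro that[of d "B / 2" "sgn (det (matrix A))"]) auto
qed

lemma det_scaleR: "det (c *\<^sub>R A) = c ^ CARD('n) * det (A :: real ^ 'n ^ 'n)"
proof -
  have "c *\<^sub>R A = (\<chi> i. c *s A $ i)" by (simp add: vec_eq_iff)
  then show ?thesis using det_rows_mul[of "\<lambda>_. c" "\<lambda>i. A $ i"] by simp
qed

text \<open>Differentiating the constant \<open>f y \<bullet> f y\<close> shows that every
  \<open>D w\<close> is orthogonal to \<open>f x\<close>. If \<open>D\<close> were onto, then
  \<open>f x\<close> itself would be such a value and hence zero.\<close>

lemma det_eq_0_if_norm_constant: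
  fixes f :: "real ^ 'n \<Rightarrow> real ^ 'n"
  assumes f: "(f has_derivative D) (at x)" and "open U" "x \<in> U"
    and const: "\<And>y. y \<in> U \<Longrightarrow> norm (f y) = r" and "r > 0"
  shows "det (matrix D) = 0"
proof (rule ccontr)
  assume "det (matrix D) \<noteq> 0"
  then have "surj ((*v) (matrix D))"
    by (simp add: invertible_det_nz[symmetric] invertible_right_inverse matrix_right_invertible_surjective)
  then obtain w where "matrix D *v w = f x" by (metis surjD)
  then have w: "D w = f x" using matrix_mult_has_derivative[OF f] by simp
  have "((\<lambda>y. f y \<bullet> f y) has_derivative (\<lambda>w. f x \<bullet> D w + D w \<bullet> f x)) (at x)"
    by (intro derivative_intros f)
  moreover have "((\<lambda>y. f y \<bullet> f y) has_derivative (\<lambda>w. 0)) (at x)"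
    using has_derivative_const[of "r\<^sup>2" "at x"] \<open>open U\<close> \<open>x \<in> U\<close>
    by (rule has_derivative_transform_within_open) (simp add: const power2_norm_eq_inner[symmetric])
  ultimately have "(\<lambda>w. f x \<bullet> D w + D w \<bullet> f x) = (\<lambda>w. 0)" by (rule has_derivative_unique)
  from fun_cong[OF this, of w] have "norm (f x) = 0" by (simp add: w)
  with const[OF \<open>x \<in> U\<close>] \<open>r > 0\<close> show False by simp
qed

text \<open>Replacing a sign by its negative changes the sum by 2. The witness \<open>k\<close>
  makes the congruence usable for a sum of reals.\<close>

lemma sum_signs_parity:
  assumes "finite Z" "\<And>a. a \<in> Z \<Longrightarrow> s a = 1 \<or> s a = (-1::real)"
  shows "\<exists>k::int. sum s Z = of_int (int (card Z) + 2 * k)"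
  using assms
proof (induction Z rule: finite_induct)
  case (insert a Z)
  then obtain k :: int where "sum s Z = of_int (int (card Z) + 2 * k)" by auto
  then show ?case
    using insert.prems[of a] insert.hyps
    by (auto intro: exI[of _ k] exI[of _ "k - 1"])
qed (auto intro: exI[of _ 0])

lemma uniform_positive_lower_bound:
  assumes "finite Z" "\<And>a. a \<in> Z \<Longrightarrow> \<phi> a > (0::real)"
  obtains \<delta> where "\<delta> > 0" "\<And>a. a \<in> Z \<Longrightarrow> \<delta> \<le> \<phi> a"
proof
  show "Min (insert 1 (\<phi> ` Z)) > 0" using assms by (subst Min_gr_iff) auto
  show "Min (insert 1 (\<phi> ` Z)) \<le> \<phi> a" if "a \<in> Z" for a using assms that by (intro Min_le) auto
qed

lemma finite_if_locally_unique:
  assumes "compact Z" "\<And>a. a \<in> Z \<Longrightarrow> \<exists>d>0. \<forall>x\<in>Z. dist a x < d \<longrightarrow> x = a"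
  shows "finite Z"
proof -
  obtain d where d: "\<And>a. a \<in> Z \<Longrightarrow> d a > 0" "\<And>a x. a \<in> Z \<Longrightarrow> x \<in> Z \<Longrightarrow> dist a x < d a \<Longrightarrow> x = a"
    using assms(2) by metis
  have "Z \<subseteq> (\<Union>a\<in>Z. ball a (d a))" using d(1) by force
  then obtain C where C: "C \<subseteq> Z" "finite C" "Z \<subseteq> (\<Union>a\<in>C. ball a (d a))"
    using compactE_image[OF assms(1), of Z "\<lambda>a. ball a (d a)"] by auto
  then have "Z \<subseteq> C" using d(2) by fastforce
  with C show ?thesis using finite_subset by blast
qed

theorem odd_card_zeros_wellorder:
  fixes g :: "real ^ 'n::{finite,wellorder} \<Rightarrow> real ^ 'n::_"
  assumes lip: "\<And>x y. norm (g x - g y) \<le> L * norm (x - y)"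
    and id: "\<And>x. R \<le> norm x \<Longrightarrow> g x = x" and "R > 0"
    and N: "negligible N" and diff: "\<And>x. x \<notin> N \<Longrightarrow> g differentiable (at x)"
    and strict: "\<And>a. g a = 0 \<Longrightarrow> \<exists>A. has_strict_derivative g A a \<and> inj A"
  shows "finite {x. g x = 0} \<and> odd (card {x. g x = 0})"
proof -
  define Z where "Z = {x. g x = 0}"
  have cont: "continuous_on S g" for S
  proof (rule lipschitz_on_continuous_on)
    have "norm (g x - g y) \<le> \<bar>L\<bar> * norm (x - y)" for x y
      using lip[of x y] by (rule order_trans) (intro mult_right_mono, auto)
    then show "\<bar>L\<bar>-lipschitz_on S g"
      by (intro lipschitz_onI) (auto simp: dist_norm)
  qed
  \<comment> \<open>The radius, the lower Lipschitz constant and the sign are bundled so that they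
    can be chosen together as functions of the zero.\<close>
  define Q where "Q a d c s \<longleftrightarrow> d > 0 \<and> c > 0 \<and> (s = 1 \<or> s = (-1 :: real)) \<and>
      (\<forall>x\<in>ball a d. \<forall>y\<in>ball a d. c * norm (x - y) \<le> norm (g x - g y)) \<and>
      (\<forall>x\<in>ball a d. \<forall>D. (g has_derivative D) (at x) \<longrightarrow> det (matrix D) = s * \<bar>det (matrix D)\<bar>)"
    for a d c s
  have "\<exists>d c s. Q a d c s" if a: "a \<in> Z" for a
  proof -
    obtain A where A: "has_strict_derivative g A a" "inj A"
      using strict[of a] a by (auto simp: Z_def)
    show ?thesis
      unfolding Q_def by (rule has_strict_derivative_inj_nhds[OF A]) blast
  qed
  then obtain d c s where Q: "\<And>a. a \<in> Z \<Longrightarrow> Q a (d a) (c a) (s a)"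
    by metis
  have d: "d a > 0" and c: "c a > 0" and s: "s a = 1 \<or> s a = -1" if "a \<in> Z" for a
    using Q[OF that] by (auto simp: Q_def)
  have below: "c a * norm (x - y) \<le> norm (g x - g y)"
    if "a \<in> Z" "x \<in> ball a (d a)" "y \<in> ball a (d a)" for a x y
    using Q[OF that(1)] that(2,3) by (simp add: Q_def)
  have sign: "det (matrix D) = s a * \<bar>det (matrix D)\<bar>"
    if "a \<in> Z" "x \<in> ball a (d a)" "(g has_derivative D) (at x)" for a x D
    using Q[OF that(1)] that(2,3) unfolding Q_def by blast
  have inj: "inj_on g (ball a (d a))" if "a \<in> Z" for a
  proof (rule inj_onI)
    fix x y assume "x \<in> ball a (d a)" "y \<in> ball a (d a)" "g x = g y"
    with below[OF that, of x y] c[OF that] show "x = y" by (simp add: mult_le_0_iff)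
  qed
  have Z_unique: "x = a" if "a \<in> Z" "x \<in> Z" "dist a x < d a" for a x
    using inj_onD[OF inj[OF that(1)], of x a] that d by (auto simp: Z_def)
  have fin: "finite Z"
  proof (rule finite_if_locally_unique)
    have "closed Z"
      unfolding Z_def using continuous_closed_preimage_constant[of UNIV g 0] cont by simp
    moreover have "Z \<subseteq> cball 0 R"
      unfolding Z_def using id \<open>R > 0\<close> by (auto intro: ccontr simp: not_le)
    ultimately show "compact Z" by (metis bounded_cball bounded_subset compact_eq_bounded_closed)
  qed (use d Z_unique in blast)
  \<comment> \<open>Half the distance to the nearest other zero, capped by the radius of good
    behaviour: balls of a common radius \<open>\<delta>\<close> below all these values are pairwise
    disjoint.\<close>
  define sep where "sep a = Min (insert (d a) ((\<lambda>b. dist a b / 2) ` (Z - {a})))" for a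
  have sep: "sep a > 0" if "a \<in> Z" for a
    using d that fin by (auto simp: sep_def)
  obtain \<delta> where \<delta>: "\<delta> > 0" "\<And>a. a \<in> Z \<Longrightarrow> \<delta> \<le> sep a"
    using uniform_positive_lower_bound[of Z sep] fin sep by blast
  have \<delta>d: "\<delta> \<le> d a" if "a \<in> Z" for a
    using \<delta>(2)[OF that] fin by (simp add: sep_def)
  have disj: "a = b" if "a \<in> Z" "b \<in> Z" "x \<in> ball a \<delta>" "x \<in> ball b \<delta>" for a b x
  proof (rule ccontr)
    assume "a \<noteq> b"
    then have "sep a \<le> dist a b / 2" unfolding sep_def using fin that by (intro Min_le) auto
    with \<delta>(2)[OF that(1)] have "2 * \<delta> \<le> dist a b" by simp
    with that(3,4) dist_triangle2[of a b x] show False by (simp add: dist_commute)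
  qed
  define V where "V a = ball a \<delta>" for a :: "real ^ 'n::_"
  have V: "V a \<subseteq> ball a (d a)" if "a \<in> Z" for a
    unfolding V_def using \<delta>d[OF that] by (rule subset_ball)
  \<comment> \<open>By invariance of domain \<open>g\<close> maps each \<open>V a\<close> onto an
    open set, which contains \<open>g a = 0\<close> and hence a ball around 0.\<close>
  have "\<exists>\<eta>>0. ball 0 \<eta> \<subseteq> g ` V a" if "a \<in> Z" for a
  proof -
    have "open (g ` V a)"
      using inj_on_subset[OF inj V] that by (intro invariance_of_domain cont) (auto simp: V_def)
    moreover have "0 \<in> g ` V a" using that \<delta>(1) by (force simp: V_def Z_def)
    ultimately show ?thesis unfolding open_contains_ball by blast
  qed
  then obtain \<eta> where \<eta>: "\<And>a. a \<in> Z \<Longrightarrow> \<eta> a > 0" "\<And>a. a \<in> Z \<Longrightarrow> ball 0 (\<eta> a) \<subseteq> g ` V a" by metis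
  obtain \<eta>0 where \<eta>0: "\<eta>0 > 0" "\<And>a. a \<in> Z \<Longrightarrow> \<eta>0 \<le> \<eta> a"
    using uniform_positive_lower_bound[of Z \<eta>] fin \<eta>(1) by blast
  define W where "W = (\<Union>a\<in>Z. V a)"
  \<comment> \<open>On the compact rest of the ball \<open>g\<close> has no zero, so its norm
    attains a positive minimum; if nothing is left, any constant serves.\<close>
  obtain \<epsilon>0 where \<epsilon>0: "\<epsilon>0 > 0" "\<And>x. norm x \<le> R \<Longrightarrow> x \<notin> W \<Longrightarrow> \<epsilon>0 \<le> norm (g x)"
  proof (cases "cball 0 R - W = {}")
    case True
    then show ?thesis by (intro that[of 1]) auto
  next
    case False
    have "compact (cball 0 R - W)" by (intro compact_diff) (auto simp: W_def V_def)
    then obtain x0 where x0: "x0 \<in> cball 0 R - W" "\<And>x. x \<in> cball 0 R - W \<Longrightarrow> norm (g x0) \<le> norm (g x)"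
      using continuous_attains_inf[OF _ False, of "\<lambda>x. norm (g x)"] cont
      by (metis continuous_on_norm)
    have "a \<in> W" if "a \<in> Z" for a using that \<delta>(1) by (force simp: W_def V_def)
    then have "g x0 \<noteq> 0" using x0(1) by (auto simp: Z_def)
    with x0 show ?thesis by (intro that[of "norm (g x0)"]) auto
  qed
  \<comment> \<open>Being below \<open>R\<close> and \<open>\<epsilon>0\<close>, this radius
    confines small values of \<open>g\<close> to the sets \<open>V a\<close> inside the ball of
    radius \<open>R\<close>. Being at most \<open>\<eta>0\<close>, it ensures that every
    \<open>V a\<close> covers the whole ball of radius \<open>\<epsilon>\<close>.\<close>
  define \<epsilon> where "\<epsilon> = min (R / 2) (min (\<epsilon>0 / 2) \<eta>0)"
  have \<epsilon>: "\<epsilon> > 0" "\<epsilon> < R" "\<epsilon> < \<epsilon>0" "\<epsilon> \<le> \<eta>0"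
    using \<open>R > 0\<close> \<epsilon>0(1) \<eta>0(1) by (auto simp: \<epsilon>_def min_def)
  have inW: "x \<in> W" "norm x < R" if "norm (g x) \<le> \<epsilon>" for x
  proof -
    show "norm x < R" using id[of x] that \<epsilon> by (cases "R \<le> norm x") auto
    then show "x \<in> W" using \<epsilon>0(2)[of x] that \<epsilon> by fastforce
  qed
  \<comment> \<open>For \<open>norm x \<le> R\<close> the last summand vanishes; for \<open>norm x \<ge> R\<close> both projections are radial
    and \<open>f x = x\<close>.\<close>
  define f where "f x = (R / \<epsilon>) *\<^sub>R closest_point (cball 0 \<epsilon>) (g x) + (x - closest_point (cball 0 R) x)" for x
  have f_small: "f x = (R / \<epsilon>) *\<^sub>R g x" if "norm (g x) \<le> \<epsilon>" for x
    using inW(2)[OF that] that by (simp add: f_def closest_point_self)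
  have f_large: "f x = (R / norm (g x)) *\<^sub>R g x" if "norm (g x) \<ge> \<epsilon>" "norm x \<le> R" for x
    using that \<epsilon> by (simp add: f_def closest_point_self closest_point_cball_0)
  have f_id: "f x = x" if "R \<le> norm x" for x
    using that \<epsilon> \<open>R > 0\<close> by (simp add: f_def closest_point_cball_0 id)
  define L' where "L' = R / \<epsilon> * L + 2"
  have f_lip: "norm (f x - f y) \<le> L' * norm (x - y)" for x y
  proof -
    let ?p = "\<lambda>x. closest_point (cball 0 \<epsilon>) (g x)" and ?q = "closest_point (cball (0 :: real ^ 'n::_) R)"
    have p: "norm (?p x - ?p y) \<le> L * norm (x - y)"
      using closest_point_lipschitz[of "cball 0 \<epsilon>" "g x" "g y"] lip[of x y] \<epsilon> by (simp add: dist_norm)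
    have q: "norm (?q x - ?q y) \<le> norm (x - y)"
      using closest_point_lipschitz[of "cball 0 R" x y] \<open>R > 0\<close> by (simp add: dist_norm)
    have "f x - f y = (R / \<epsilon>) *\<^sub>R (?p x - ?p y) + ((x - y) - (?q x - ?q y))"
      by (simp add: f_def algebra_simps)
    also have "norm \<dots> \<le> R / \<epsilon> * norm (?p x - ?p y) + (norm (x - y) + norm (?q x - ?q y))"
      using \<epsilon> \<open>R > 0\<close> by (intro order_trans[OF norm_triangle_ineq] add_mono norm_triangle_ineq4) simp
    also have "\<dots> \<le> R / \<epsilon> * (L * norm (x - y)) + (norm (x - y) + norm (x - y))"
      using p q \<epsilon> \<open>R > 0\<close> by (intro add_mono mult_left_mono) auto
    finally show ?thesis by (simp add: L'_def algebra_simps)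
  qed
  \<comment> \<open>Besides \<open>N\<close>, this contains the points where one of the two
    projections in \<open>f\<close> may have a kink: the sphere of radius \<open>R\<close> and the
    preimage of the sphere of radius \<open>\<epsilon>\<close>.\<close>
  define N' where "N' = N \<union> sphere 0 R \<union> (\<Union>a\<in>Z. {x \<in> V a. norm (g x) = \<epsilon>})"
  have "negligible {x \<in> V a. norm (g x) = \<epsilon>}" if a: "a \<in> Z" for a
  proof -
    let ?T = "{x \<in> V a. norm (g x) = \<epsilon>}"
    \<comment> \<open>On \<open>V a\<close> the lower bound for \<open>g\<close> makes the inverse
      \<open>q\<close> Lipschitz. So the preimage of a sphere is a Lipschitz image of a null
      set.\<close>
    define q where "q = inv_into (V a) g"
    have injV: "inj_on g (V a)" using inj_on_subset[OF inj V] a by blast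
    have q: "q (g x) = x" if "x \<in> V a" for x using injV that by (simp add: q_def)
    have "negligible (q ` g ` ?T)"
    proof (rule negligible_Lipschitz_image[OF order_refl])
      show "negligible (g ` ?T)"
        by (rule negligible_subset[OF negligible_sphere[of 0 \<epsilon>]]) auto
      show "norm (q y - q z) \<le> (1 / c a) * norm (y - z)" if "y \<in> g ` ?T" "z \<in> g ` ?T" for y z
        using that below[OF a] V[OF a] c[OF a] by (auto simp: q field_simps subset_iff)
    qed
    moreover have "q ` g ` ?T = ?T" using q by force
    ultimately show ?thesis by simp
  qed
  then have N': "negligible N'"
    unfolding N'_def using N fin by (intro negligible_Un negligible_Union negligible_sphere) auto
  have gdiff: "(g has_derivative frechet_derivative g (at x)) (at x)" if "x \<notin> N'" for x
    using diff[of x] that by (simp add: N'_def frechet_derivative_works)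
  have open_small: "open {y. norm (g y) < \<epsilon>}" and open_large: "open {y. norm (g y) > \<epsilon>}"
    using cont[of UNIV] by (auto intro!: open_Collect_less continuous_intros)
  have f_der_small: "(f has_derivative (\<lambda>w. (R / \<epsilon>) *\<^sub>R frechet_derivative g (at x) w)) (at x)"
    if "x \<notin> N'" "norm (g x) < \<epsilon>" for x
  proof (rule has_derivative_transform_within_open[OF _ open_small])
    show "((\<lambda>y. (R / \<epsilon>) *\<^sub>R g y) has_derivative (\<lambda>w. (R / \<epsilon>) *\<^sub>R frechet_derivative g (at x) w)) (at x)"
      by (intro derivative_intros gdiff that)
  qed (use that f_small in auto)
  define U where "U = {y. norm (g y) > \<epsilon>} \<inter> ball 0 R"
  have "open U" unfolding U_def using open_large by blast
  have f_diff: "f differentiable (at x)" if x: "x \<notin> N'" for x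
  proof -
    \<comment> \<open>A point with \<open>norm (g x) = \<epsilon>\<close> lies in some
      \<open>V a\<close> and therefore in \<open>N'\<close>.\<close>
    consider "norm (g x) < \<epsilon>" | "x \<in> U" | "R < norm x"
      using x inW[of x] by (cases "norm (g x) = \<epsilon>") (force simp: N'_def W_def U_def)+
    then show ?thesis
    proof cases
      case 1
      then show ?thesis using f_der_small[OF x] by (auto simp: differentiable_def)
    next
      case 2
      have "g x \<noteq> 0" using 2 \<epsilon> by (auto simp: U_def)
      have gx: "g differentiable (at x)" using gdiff[OF x] by (rule differentiableI)
      have "(\<lambda>y. norm (g y)) differentiable (at x)"
        by (rule differentiable_compose[OF differentiable_norm_at[OF \<open>g x \<noteq> 0\<close>] gx])
      then have "(\<lambda>y. (R / norm (g y)) *\<^sub>R g y) differentiable (at x)"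
        by (rule differentiable_scaleR[OF differentiable_divide[OF differentiable_const] gx])
          (simp add: \<open>g x \<noteq> 0\<close>)
      then obtain D where D: "((\<lambda>y. (R / norm (g y)) *\<^sub>R g y) has_derivative D) (at x)"
        by (auto simp: differentiable_def)
      have "(f has_derivative D) (at x)"
        by (rule has_derivative_transform_within_open[OF D \<open>open U\<close> 2]) (simp add: U_def f_large)
      then show ?thesis by (rule differentiableI)
    next
      case 3
      have "(f has_derivative (\<lambda>w. w)) (at x)"
        by (rule has_derivative_transform_within_open[OF has_derivative_ident, where s = "- cball 0 R"])
          (use 3 in \<open>auto simp: f_id\<close>)
      then show ?thesis by (rule differentiableI)
    qed
  qed
  define f' where "f' x = frechet_derivative f (at x)" for x
  have f': "(f has_derivative f' x) (at x)" if "x \<notin> N'" for x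
    using f_diff[OF that] by (simp add: f'_def frechet_derivative_works)
  let ?B = "ball (0 :: real ^ 'n::_) R"
  \<comment> \<open>On \<open>M a\<close> the map \<open>f\<close> is a rescaling of
    \<open>g\<close> and a bijection onto the ball of radius \<open>R\<close>, so each zero
    contributes one full volume up to sign.\<close>
  define M where "M a = {x \<in> V a. norm (g x) < \<epsilon>}" for a
  have MB: "M a \<subseteq> ?B" for a using inW(2) by (auto simp: M_def)
  have piece: "((\<lambda>x. \<bar>det (matrix (f' x))\<bar>) has_integral measure lebesgue ?B) (M a - N')" if a: "a \<in> Z" for a
  proof (rule has_integral_abs_det_Lipschitz_bij[OF _ _ _ f_lip N'])
    have "M a = V a \<inter> {y. norm (g y) < \<epsilon>}" by (auto simp: M_def)
    then show "open (M a)" using open_small by (auto simp: V_def)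
    have fM: "f x = (R / \<epsilon>) *\<^sub>R g x" if "x \<in> M a" for x using that f_small by (auto simp: M_def)
    have injM: "inj_on g (M a)"
      using inj_on_subset[OF inj[OF a], of "M a"] V[OF a] by (auto simp: M_def)
    show "bij_betw f (M a) ?B"
      unfolding bij_betw_def
    proof (intro conjI set_eqI iffI)
      show "inj_on f (M a)"
        using injM \<epsilon> \<open>R > 0\<close> by (auto simp: inj_on_def fM)
      show "y \<in> ?B" if "y \<in> f ` M a" for y
        using that \<epsilon> \<open>R > 0\<close> by (auto simp: fM) (auto simp: M_def field_simps)
      show "y \<in> f ` M a" if "y \<in> ?B" for y
      proof -
        have small: "norm ((\<epsilon> / R) *\<^sub>R y) < \<epsilon>" using that \<epsilon> \<open>R > 0\<close> by (simp add: field_simps)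
        then have "(\<epsilon> / R) *\<^sub>R y \<in> ball 0 (\<eta> a)" using \<epsilon> \<eta>0(2)[OF a] by auto
        then obtain x where "x \<in> V a" "g x = (\<epsilon> / R) *\<^sub>R y" using \<eta>(2)[OF a] by (metis imageE subsetD)
        then have "x \<in> M a" "f x = y"
          using small fM[of x] \<epsilon> \<open>R > 0\<close> by (auto simp: M_def)
        then show ?thesis by blast
      qed
    qed
  qed (use f' in auto)
  have "((\<lambda>x. \<Sum>a\<in>Z. s a * (if x \<in> M a - N' then \<bar>det (matrix (f' x))\<bar> else 0))
      has_integral (\<Sum>a\<in>Z. s a * measure lebesgue ?B)) (?B - N')"
  proof (intro has_integral_sum has_integral_mult_right fin)
    fix a assume "a \<in> Z"
    have "M a - N' \<subseteq> ?B - N'" using MB by blast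
    then show "((\<lambda>x. if x \<in> M a - N' then \<bar>det (matrix (f' x))\<bar> else 0) has_integral measure lebesgue ?B) (?B - N')"
      using piece[OF \<open>a \<in> Z\<close>] by (simp only: has_integral_restrict)
  qed
  \<comment> \<open>Where \<open>g\<close> is small, disjointness leaves the summand of a single
    zero, and its sign recovers the determinant. Elsewhere \<open>f\<close> has constant norm
    \<open>R\<close> near \<open>x\<close>, so the determinant vanishes.\<close>
  moreover have "(\<Sum>a\<in>Z. s a * (if x \<in> M a - N' then \<bar>det (matrix (f' x))\<bar> else 0)) = det (matrix (f' x))"
    if x: "x \<in> ?B - N'" for x
  proof (cases "norm (g x) \<le> \<epsilon>")
    case True
    then obtain a where a: "a \<in> Z" "x \<in> V a" using inW(1) by (auto simp: W_def)
    then have less: "norm (g x) < \<epsilon>" using True x by (force simp: N'_def)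
    have "(\<Sum>b\<in>Z. s b * (if x \<in> M b - N' then \<bar>det (matrix (f' x))\<bar> else 0))
        = (\<Sum>b\<in>Z. if b = a then s a * \<bar>det (matrix (f' x))\<bar> else 0)"
      using x a less disj by (intro sum.cong) (auto simp: M_def V_def)
    also have "\<dots> = s a * \<bar>det (matrix (f' x))\<bar>" using fin a by simp
    also have "\<dots> = det (matrix (f' x))"
    proof -
      have "f' x = (\<lambda>w. (R / \<epsilon>) *\<^sub>R frechet_derivative g (at x) w)"
        using has_derivative_unique[OF f' f_der_small] x less by blast
      then have "matrix (f' x) = (R / \<epsilon>) *\<^sub>R matrix (frechet_derivative g (at x))"
        by (simp add: matrix_def vec_eq_iff)
      then have "det (matrix (f' x)) = (R / \<epsilon>) ^ CARD('n) * det (matrix (frechet_derivative g (at x)))"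
        by (simp add: det_scaleR)
      moreover have "det (matrix (frechet_derivative g (at x))) = s a * \<bar>det (matrix (frechet_derivative g (at x)))\<bar>"
        using sign[OF a(1) _ gdiff] V[OF a(1)] a(2) x by blast
      ultimately show ?thesis using \<epsilon> \<open>R > 0\<close> by (simp add: abs_mult)
    qed
    finally show ?thesis .
  next
    case False
    have "norm (f y) = R" if "y \<in> U" for y
      using that \<epsilon> \<open>R > 0\<close> f_large[of y] by (auto simp: U_def)
    then have "det (matrix (f' x)) = 0"
      using det_eq_0_if_norm_constant[OF f' \<open>open U\<close>] x False \<open>R > 0\<close> by (auto simp: U_def)
    moreover have "x \<notin> M a" for a using False by (simp add: M_def)
    ultimately show ?thesis by simp
  qed
  ultimately have "((\<lambda>x. det (matrix (f' x))) has_integral (\<Sum>a\<in>Z. s a * measure lebesgue ?B)) (?B - N')"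
    by (rule has_integral_eq[rotated])
  moreover have "((\<lambda>x. det (matrix (f' x))) has_integral measure lebesgue ?B) (?B - N')"
    using f_lip f_id N' f' by (rule has_integral_det_Jacobian_ball)
  ultimately have "(\<Sum>a\<in>Z. s a * measure lebesgue ?B) = measure lebesgue ?B"
    by (rule has_integral_unique)
  then have "sum s Z * measure lebesgue ?B = measure lebesgue ?B"
    by (simp only: sum_distrib_right)
  then have "sum s Z = 1"
    using content_ball_pos[OF \<open>R > 0\<close>, of "0 :: real ^ 'n::_"] by simp
  moreover obtain k :: int where "sum s Z = of_int (int (card Z) + 2 * k)"
    using sum_signs_parity[of Z s] fin s by blast
  ultimately have "int (card Z) + 2 * k = 1" by linarith
  then have "odd (card Z)" by presburger
  with fin show ?thesis by (simp add: Z_def)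
qed

text \<open>
  The change of variables theorem of the library is restricted to well-ordered index types; this
  copy of the index type lets its consequences be transferred to arbitrary finite ones.
\<close>

typedef ('n::finite) wo_index = "{..<CARD('n)}"
  by (auto intro!: exI[of _ 0])

instantiation wo_index :: (finite) wellorder
begin

definition less_eq_wo_index :: "'a wo_index \<Rightarrow> 'a wo_index \<Rightarrow> bool" where
  "x \<le> y \<longleftrightarrow> Rep_wo_index x \<le> Rep_wo_index y"

definition less_wo_index :: "'a wo_index \<Rightarrow> 'a wo_index \<Rightarrow> bool" where
  "x < y \<longleftrightarrow> Rep_wo_index x < Rep_wo_index y"

instance
proof
  fix P :: "'a wo_index \<Rightarrow> bool" and a
  assume "\<And>x. (\<And>y. y < x \<Longrightarrow> P y) \<Longrightarrow> P x"
  then show "P a"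
    by (rule measure_induct_rule[of Rep_wo_index]) (simp add: less_wo_index_def)
qed (auto simp: less_eq_wo_index_def less_wo_index_def Rep_wo_index_inject)

end

lemma card_wo_index: "CARD('n::finite wo_index) = CARD('n)"
  using type_definition.card[OF type_definition_wo_index] by simp

instance wo_index :: (finite) finite
  by standard (simp add: type_definition.univ[OF type_definition_wo_index])

lemma has_strict_derivative_isometry_conj:
  fixes \<Phi> :: "'a::real_normed_vector \<Rightarrow> 'b::real_normed_vector"
  assumes g: "has_strict_derivative g A (\<Psi> b)"
    and \<Phi>: "bounded_linear \<Phi>" "\<And>x. norm (\<Phi> x) = norm x"
    and \<Psi>: "bounded_linear \<Psi>" "\<And>y. norm (\<Psi> y) = norm y"
  shows "has_strict_derivative (\<lambda>y. \<Phi> (g (\<Psi> y))) (\<lambda>w. \<Phi> (A (\<Psi> w))) b"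
proof (rule has_strict_derivativeI)
  show "bounded_linear (\<lambda>w. \<Phi> (A (\<Psi> w)))"
    using bounded_linear_compose[OF \<Phi>(1)]
      bounded_linear_compose[OF has_strict_derivative_bounded_linear[OF g] \<Psi>(1)] by blast
  interpret \<Phi>: bounded_linear \<Phi> by fact
  interpret \<Psi>: bounded_linear \<Psi> by fact
  fix e :: real assume "e > 0"
  then obtain d where "d > 0" and d: "\<And>x y. x \<in> ball (\<Psi> b) d \<Longrightarrow> y \<in> ball (\<Psi> b) d \<Longrightarrow>
      norm (g x - g y - A (x - y)) \<le> e * norm (x - y)"
    using has_strict_derivativeD[OF g] by metis
  have "norm (\<Phi> (g (\<Psi> x)) - \<Phi> (g (\<Psi> y)) - \<Phi> (A (\<Psi> (x - y)))) \<le> e * norm (x - y)"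
    if "x \<in> ball b d" "y \<in> ball b d" for x y
    using d[of "\<Psi> x" "\<Psi> y"] that by (simp add: dist_norm \<Phi>(2) \<Psi>(2) flip: \<Phi>.diff \<Psi>.diff)
  with \<open>d > 0\<close> show "\<exists>d>0. \<forall>x\<in>ball b d. \<forall>y\<in>ball b d.
      norm (\<Phi> (g (\<Psi> x)) - \<Phi> (g (\<Psi> y)) - \<Phi> (A (\<Psi> (x - y)))) \<le> e * norm (x - y)"
    by blast
qed

text \<open>Relabelling coordinates along a bijection of the index types is a linear isometry. All
  hypotheses carry over with the same \<open>L\<close> and \<open>R\<close>, and the zeros
  correspond bijectively.\<close>

theorem odd_card_zeros:
  fixes g :: "real ^ 'n \<Rightarrow> real ^ 'n"
  assumes lip: "\<And>x y. norm (g x - g y) \<le> L * norm (x - y)"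
    and id: "\<And>x. R \<le> norm x \<Longrightarrow> g x = x" and "R > 0"
    and N: "negligible N" and diff: "\<And>x. x \<notin> N \<Longrightarrow> g differentiable (at x)"
    and strict: "\<And>a. g a = 0 \<Longrightarrow> \<exists>A. has_strict_derivative g A a \<and> inj A"
  shows "finite {x. g x = 0} \<and> odd (card {x. g x = 0})"
proof -
  obtain \<pi> :: "'n wo_index \<Rightarrow> 'n" where \<pi>: "bij \<pi>"
    using finite_same_card_bij[of "UNIV :: 'n wo_index set" "UNIV :: 'n set"] card_wo_index by auto
  define \<Phi> :: "real ^ 'n \<Rightarrow> real ^ 'n wo_index" where "\<Phi> x = (\<chi> i. x $ \<pi> i)" for x
  define \<Psi> :: "real ^ 'n wo_index \<Rightarrow> real ^ 'n" where "\<Psi> y = (\<chi> j. y $ inv \<pi> j)" for y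
  have inverse: "\<Psi> (\<Phi> x) = x" "\<Phi> (\<Psi> y) = y" for x y
    using \<pi> by (simp_all add: \<Phi>_def \<Psi>_def vec_eq_iff bij_is_surj bij_is_inj surj_f_inv_f)
  have norm_\<Phi>: "norm (\<Phi> x) = norm x" for x
    unfolding \<Phi>_def norm_vec_def L2_set_def
    using sum.reindex_bij_betw[OF \<pi>, of "\<lambda>i. (norm (x $ i))\<^sup>2"] by simp
  then have norm_\<Psi>: "norm (\<Psi> y) = norm y" for y
    by (metis inverse(2))
  have linear: "bounded_linear \<Phi>" "bounded_linear \<Psi>"
    unfolding linear_conv_bounded_linear[symmetric]
    by (auto simp: \<Phi>_def \<Psi>_def vec_eq_iff intro!: linearI)
  interpret \<Phi>: bounded_linear \<Phi> by (rule linear)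
  interpret \<Psi>: bounded_linear \<Psi> by (rule linear)
  define g' where "g' y = \<Phi> (g (\<Psi> y))" for y
  have "finite {y. g' y = 0} \<and> odd (card {y. g' y = 0})"
  proof (rule odd_card_zeros_wellorder)
    show "norm (g' x - g' y) \<le> L * norm (x - y)" for x y
      using lip[of "\<Psi> x" "\<Psi> y"] by (simp add: g'_def norm_\<Phi> norm_\<Psi> flip: \<Phi>.diff \<Psi>.diff)
    show "g' y = y" if "R \<le> norm y" for y
      using that by (simp add: g'_def id norm_\<Psi> inverse)
    show "negligible (\<Phi> ` N)"
      by (rule negligible_Lipschitz_image[OF _ N, where L = 1])
        (auto simp: card_wo_index norm_\<Phi> simp flip: \<Phi>.diff)
    show "g' differentiable (at y)" if "y \<notin> \<Phi> ` N" for y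
    proof -
      have "\<Psi> y \<notin> N" using that inverse(2)[of y] by (metis imageI)
      then show ?thesis
        unfolding g'_def
        using differentiable_compose[of \<Phi> "\<lambda>y. g (\<Psi> y)"] differentiable_compose[of g \<Psi> y UNIV]
          linear[THEN bounded_linear_imp_differentiable] diff by blast
    qed
    fix b assume "g' b = 0"
    then have "g (\<Psi> b) = 0" by (metis g'_def inverse(1) \<Psi>.zero)
    then obtain A where A: "has_strict_derivative g A (\<Psi> b)" "inj A" using strict by blast
    have "inj \<Phi>" by (rule inj_on_inverseI[where g = \<Psi>]) (rule inverse)
    moreover have "inj \<Psi>" by (rule inj_on_inverseI[where g = \<Phi>]) (rule inverse)
    ultimately have "inj (\<Phi> \<circ> (A \<circ> \<Psi>))"
      using A(2) by (intro inj_compose)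
    then have "inj (\<lambda>w. \<Phi> (A (\<Psi> w)))" by (simp add: o_def)
    then show "\<exists>A. has_strict_derivative g' A b \<and> inj A"
      unfolding g'_def
      using has_strict_derivative_isometry_conj[OF A(1) linear(1) norm_\<Phi> linear(2) norm_\<Psi>] by blast
  qed fact
  moreover have "{y. g' y = 0} = \<Phi> ` {x. g x = 0}"
    unfolding g'_def by (auto simp: image_iff) (metis \<Phi>.zero \<Psi>.zero inverse)+
  moreover have "inj \<Phi>"
    by (rule inj_on_inverseI[where g = \<Psi>]) (rule inverse)
  ultimately show ?thesis
    by (metis card_image finite_imageD inj_on_subset subset_UNIV)
qed

section \<open>Projection onto the simplex\<close>

text \<open>For the converse, add the inequality at \<open>x\<close> tested with the closest point
  to the one at the closest point tested with \<open>x\<close>. The sum bounds their squared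
  distance by 0.\<close>

lemma closest_point_eq_iff_dot:
  fixes S :: "'a::euclidean_space set"
  assumes S: "convex S" "closed S" and x: "x \<in> S"
  shows "closest_point S z = x \<longleftrightarrow> (\<forall>y\<in>S. (z - x) \<bullet> (y - x) \<le> 0)"
proof
  assume "closest_point S z = x"
  then show "\<forall>y\<in>S. (z - x) \<bullet> (y - x) \<le> 0"
    using closest_point_dot[OF S] by metis
next
  assume *: "\<forall>y\<in>S. (z - x) \<bullet> (y - x) \<le> 0"
  let ?c = "closest_point S z"
  have c: "?c \<in> S" using closest_point_in_set[OF S(2)] x by blast
  have "(?c - x) \<bullet> (?c - x) = (z - x) \<bullet> (?c - x) + (z - ?c) \<bullet> (x - ?c)"
    by (simp add: algebra_simps)
  also have "\<dots> \<le> 0"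
    using * c closest_point_dot[OF S x, of z] by fastforce
  finally have "(?c - x) \<bullet> (?c - x) = 0" using inner_ge_zero[of "?c - x"] by linarith
  then show "?c = x" by simp
qed

lemma prob_simplex_nonneg: "x \<in> prob_simplex \<Longrightarrow> 0 \<le> x $ i"
  and prob_simplex_sum: "x \<in> prob_simplex \<Longrightarrow> (\<Sum>i\<in>UNIV. x $ i) = 1"
  by (auto simp: prob_simplex_def)

lemma axis_in_prob_simplex: "axis i 1 \<in> prob_simplex"
  by (auto simp: prob_simplex_def axis_def)

lemma convex_prob_simplex: "convex (prob_simplex :: (real ^ 'n) set)"
  by (auto simp: convex_def prob_simplex_def sum.distrib simp flip: sum_distrib_left)

lemma compact_prob_simplex: "compact (prob_simplex :: (real ^ 'n) set)"
proof -
  have "prob_simplex = (\<Inter>i. {x :: real ^ 'n. 0 \<le> x $ i}) \<inter> {x. (\<Sum>i\<in>UNIV. x $ i) = 1}"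
    by (auto simp: prob_simplex_def)
  moreover have "closed {x :: real ^ 'n. (\<Sum>i\<in>UNIV. x $ i) = 1}"
    by (intro closed_Collect_eq continuous_intros)
  moreover have "closed {x :: real ^ 'n. 0 \<le> x $ i}" for i
    by (intro closed_Collect_le continuous_intros)
  ultimately have "closed (prob_simplex :: (real ^ 'n) set)"
    by (metis closed_INT closed_Int)
  moreover have "norm x \<le> 1" if "x \<in> prob_simplex" for x :: "real ^ 'n"
    using norm_le_l1_cart[of x] prob_simplex_nonneg[OF that] prob_simplex_sum[OF that] by simp
  then have "bounded (prob_simplex :: (real ^ 'n) set)"
    by (auto simp: bounded_iff)
  ultimately show ?thesis by (simp add: compact_eq_bounded_closed)
qed

lemmas closed_prob_simplex = compact_imp_closed[OF compact_prob_simplex]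

text \<open>Testing with the vertices gives the bounds. The weights \<open>x\<close> average the
  entries of \<open>u\<close> to \<open>u \<bullet> x\<close>, so no entry carrying positive weight
  can lie strictly below it: complementary slackness.\<close>

lemma prob_simplex_normal_cone:
  fixes x u :: "real ^ 'n"
  assumes x: "x \<in> prob_simplex"
  shows "(\<forall>y\<in>prob_simplex. u \<bullet> (y - x) \<le> 0) \<longleftrightarrow>
    (\<forall>i. u $ i \<le> u \<bullet> x \<and> (0 < x $ i \<longrightarrow> u $ i = u \<bullet> x))"
proof
  assume L: "\<forall>y\<in>prob_simplex. u \<bullet> (y - x) \<le> 0"
  have le: "u $ i \<le> u \<bullet> x" for i
    using L[rule_format, OF axis_in_prob_simplex[of i]]
    by (simp add: inner_diff_right inner_axis)
  have "(\<Sum>i\<in>UNIV. (u \<bullet> x - u $ i) * x $ i) = (u \<bullet> x) * (\<Sum>i\<in>UNIV. x $ i) - u \<bullet> x"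
    by (simp add: left_diff_distrib sum_subtractf inner_vec_def sum_distrib_left)
  then have "(\<Sum>i\<in>UNIV. (u \<bullet> x - u $ i) * x $ i) = 0"
    by (simp add: prob_simplex_sum[OF x])
  then have prod: "(u \<bullet> x - u $ i) * x $ i = 0" for i
    using le prob_simplex_nonneg[OF x]
    by (subst (asm) sum_nonneg_eq_0_iff) auto
  show "\<forall>i. u $ i \<le> u \<bullet> x \<and> (0 < x $ i \<longrightarrow> u $ i = u \<bullet> x)"
  proof (intro allI conjI impI le)
    show "u $ i = u \<bullet> x" if "0 < x $ i" for i
      using prod[of i] that by simp
  qed
next
  assume R: "\<forall>i. u $ i \<le> u \<bullet> x \<and> (0 < x $ i \<longrightarrow> u $ i = u \<bullet> x)"
  show "\<forall>y\<in>prob_simplex. u \<bullet> (y - x) \<le> 0"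
  proof
    fix y :: "real ^ 'n" assume y: "y \<in> prob_simplex"
    have "u \<bullet> y = (\<Sum>i\<in>UNIV. u $ i * y $ i)" by (simp add: inner_vec_def)
    also have "\<dots> \<le> (\<Sum>i\<in>UNIV. (u \<bullet> x) * y $ i)"
      using R prob_simplex_nonneg[OF y] by (intro sum_mono mult_right_mono) auto
    also have "\<dots> = u \<bullet> x" by (simp add: prob_simplex_sum[OF y] flip: sum_distrib_left)
    finally show "u \<bullet> (y - x) \<le> 0" by (simp add: inner_diff_right)
  qed
qed

lemma prob_simplex_normal_coneI:
  fixes x u :: "real ^ 'n"
  assumes x: "x \<in> prob_simplex" and u: "\<And>i. u $ i \<le> \<tau>" "\<And>i. 0 < x $ i \<Longrightarrow> u $ i = \<tau>"
  shows "\<forall>y\<in>prob_simplex. u \<bullet> (y - x) \<le> 0"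
proof -
  have "u \<bullet> x = (\<Sum>i\<in>UNIV. \<tau> * x $ i)"
    unfolding inner_vec_def using u(2) prob_simplex_nonneg[OF x]
    by (intro sum.cong) (auto simp: less_le)
  then have "u \<bullet> x = \<tau>" by (simp add: prob_simplex_sum[OF x] flip: sum_distrib_left)
  then show ?thesis using u by (simp add: prob_simplex_normal_cone[OF x])
qed

section \<open>Local form of the projection and its exceptional set\<close>

text \<open>For nonempty \<open>B\<close> this is the orthogonal projection onto the vectors
  supported on \<open>B\<close> with entries summing to 0, the tangent space of the face of the
  simplex with support \<open>B\<close>.\<close>

definition face_proj :: "'n set \<Rightarrow> real ^ 'n \<Rightarrow> real ^ 'n" where
  "face_proj B w = (\<chi> i. if i \<in> B then w $ i - (\<Sum>j\<in>B. w $ j) / card B else 0)"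

lemma bounded_linear_face_proj: "bounded_linear (face_proj B :: real ^ 'n \<Rightarrow> real ^ 'n)"
  unfolding linear_conv_bounded_linear[symmetric]
  by (rule linearI)
    (auto simp: face_proj_def vec_eq_iff sum.distrib sum_distrib_left add_divide_distrib algebra_simps)

lemma sum_face_proj:
  assumes "B \<noteq> {}"
  shows "(\<Sum>i\<in>UNIV. face_proj B w $ i) = (0::real)"
proof -
  have "(\<Sum>i\<in>UNIV. face_proj B w $ i) = (\<Sum>i\<in>B. w $ i - (\<Sum>j\<in>B. w $ j) / card B)"
    unfolding face_proj_def by (simp add: sum.If_cases)
  then show ?thesis using assms by (simp add: sum_subtractf card_gt_0_iff)
qed

lemma prob_simplex_support_nonempty:
  assumes "x \<in> prob_simplex"
  shows "{i. 0 < x $ i} \<noteq> {}"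
proof
  assume "{i. 0 < x $ i} = {}"
  then have "x $ i = 0" for i
    using prob_simplex_nonneg[OF assms, of i] by (auto simp: less_le)
  then show False using prob_simplex_sum[OF assms] by simp
qed

text \<open>
  The hypotheses say that \<open>x\<close> is the projection of \<open>z\<close>, with multiplier \<open>\<tau>\<close> and strict
  complementarity.
\<close>

lemma closest_point_prob_simplex_locally_affine:
  fixes x z :: "real ^ 'n"
  assumes x: "x \<in> prob_simplex"
    and pos: "\<And>i. 0 < x $ i \<Longrightarrow> z $ i = x $ i + \<tau>"
    and zero: "\<And>i. x $ i = 0 \<Longrightarrow> z $ i < \<tau>"
  obtains d where "d > 0" "\<And>z'. z' \<in> ball z d \<Longrightarrow>
    closest_point prob_simplex z' = x + face_proj {i. 0 < x $ i} (z' - z)"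
proof -
  define B where "B = {i. 0 < x $ i}"
  have B: "B \<noteq> {}" using prob_simplex_support_nonempty[OF x] by (simp add: B_def)
  then have cB: "card B > 0" by (simp add: card_gt_0_iff)
  have nB: "x $ i = 0" if "i \<notin> B" for i
    using that prob_simplex_nonneg[OF x, of i] by (simp add: B_def)
  \<comment> \<open>\<open>m i\<close> is the slack of the strict inequality at \<open>i\<close>:
    positivity of \<open>x $ i\<close>, or the gap below the multiplier. An entry of
    \<open>w\<close> and the average \<open>avg\<close> are each at most \<open>norm w\<close>, so
    \<open>2 * norm w < \<delta>\<close> preserves all these inequalities, with new multiplier
    \<open>\<tau> + avg\<close>.\<close>
  define m where "m i = (if i \<in> B then x $ i else \<tau> - z $ i)" for i
  have m: "m i > 0" for i using nB zero[of i] by (auto simp: m_def B_def)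
  obtain \<delta> where \<delta>: "\<delta> > 0" "\<And>i. \<delta> \<le> m i"
    using uniform_positive_lower_bound[of "UNIV :: 'n set" m] m by auto
  show thesis
  proof (rule that)
    show "\<delta> / 2 > 0" using \<delta> by simp
    fix z' assume z': "z' \<in> ball z (\<delta> / 2)"
    define w where "w = z' - z"
    define avg where "avg = (\<Sum>j\<in>B. w $ j) / card B"
    have w: "2 * norm w < \<delta>" using z' by (simp add: w_def dist_norm norm_minus_commute)
    have wi: "\<bar>w $ i\<bar> \<le> norm w" for i by (rule component_le_norm_cart)
    have "\<bar>\<Sum>j\<in>B. w $ j\<bar> \<le> (\<Sum>j\<in>B. norm w)"
      by (rule order_trans[OF sum_abs]) (intro sum_mono wi)
    then have avg: "\<bar>avg\<bar> \<le> norm w"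
      using cB by (simp add: avg_def abs_divide divide_le_eq mult.commute)
    define x' where "x' = x + face_proj B w"
    have x'B: "x' $ i = x $ i + (w $ i - avg)" if "i \<in> B" for i
      using that by (simp add: x'_def face_proj_def avg_def)
    have x'nB: "x' $ i = 0" if "i \<notin> B" for i
      using that nB by (simp add: x'_def face_proj_def)
    have x'_pos: "x' $ i > 0" if "i \<in> B" for i
      using x'B[OF that] \<delta>(2)[of i] w wi[of i] avg that by (simp add: m_def)
    have "(\<Sum>i\<in>UNIV. x' $ i) = 1"
      using prob_simplex_sum[OF x] sum_face_proj[OF B, of w] by (simp add: x'_def sum.distrib)
    moreover have "x' $ i \<ge> 0" for i using x'_pos[of i] x'nB[of i] by fastforce
    ultimately have x': "x' \<in> prob_simplex" by (simp add: prob_simplex_def)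
    have "\<forall>y\<in>prob_simplex. (z' - x') \<bullet> (y - x') \<le> 0"
    proof (rule prob_simplex_normal_coneI[OF x'])
      have eq: "(z' - x') $ i = \<tau> + avg" if "i \<in> B" for i
        using pos[of i] x'B[OF that] that by (simp add: B_def w_def)
      then show "(z' - x') $ i = \<tau> + avg" if "0 < x' $ i" for i
        using x'nB[of i] that by fastforce
      show "(z' - x') $ i \<le> \<tau> + avg" for i
      proof (cases "i \<in> B")
        case False
        then show ?thesis
          using x'nB \<delta>(2)[of i] w wi[of i] avg by (simp add: m_def w_def)
      next
        case True
        then show ?thesis using eq[of i] by simp
      qed
    qed
    then have "closest_point prob_simplex z' = x'"
      using closest_point_eq_iff_dot[OF convex_prob_simplex closed_prob_simplex x'] by blast
    then show "closest_point prob_simplex z' = x + face_proj {i. 0 < x $ i} (z' - z)"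
      by (simp add: x'_def w_def B_def)
  qed
qed

text \<open>
  The points whose projection violates strict complementarity: if \<open>B\<close> is the support of the
  projection then its multiplier is \<open>((\<Sum>j\<in>B. z $ j) - 1) / card B\<close>.
\<close>

definition degenerate_points :: "(real ^ 'n) set" where
  "degenerate_points = (\<Union>B\<in>{B. B \<noteq> {}}. \<Union>i. {z. card B * z $ i = (\<Sum>j\<in>B. z $ j) - 1})"

lemma negligible_degenerate_points: "negligible (degenerate_points :: (real ^ 'n) set)"
proof -
  have "negligible {z :: real ^ 'n. card B * z $ i = (\<Sum>j\<in>B. z $ j) - 1}" for B i
  proof -
    define a :: "real ^ 'n" where "a = (\<Sum>j\<in>B. axis j 1) - card B *\<^sub>R axis i 1"
    have "a \<bullet> z = (\<Sum>j\<in>B. z $ j) - card B * z $ i" for z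
      by (simp add: a_def inner_diff_left inner_sum_left inner_axis')
    then have "{z. card B * z $ i = (\<Sum>j\<in>B. z $ j) - 1} = {z. a \<bullet> z = 1}"
      by auto
    \<comment> \<open>When \<open>B = {i}\<close> the vector \<open>a\<close> is zero; the
      right-hand side 1 then makes the set empty.\<close>
    then show ?thesis using negligible_hyperplane[of a 1] by simp
  qed
  then show ?thesis
    unfolding degenerate_points_def by (intro negligible_Union) auto
qed

text \<open>Summing \<open>z $ j = x $ j + \<tau>\<close> over the support determines
  \<open>\<tau>\<close> from \<open>z\<close>. A tie \<open>z $ i = \<tau>\<close> at a zero
  coordinate is then one of the excluded linear equations.\<close>

lemma closest_point_prob_simplex_multiplier:
  fixes z :: "real ^ 'n"
  assumes "z \<notin> degenerate_points"
  defines "x \<equiv> closest_point prob_simplex z"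
  obtains \<tau> where "\<And>i. 0 < x $ i \<Longrightarrow> z $ i = x $ i + \<tau>" "\<And>i. x $ i = 0 \<Longrightarrow> z $ i < \<tau>"
proof -
  have x: "x \<in> prob_simplex"
    unfolding x_def using axis_in_prob_simplex by (intro closest_point_in_set closed_prob_simplex) auto
  have "\<forall>y\<in>prob_simplex. (z - x) \<bullet> (y - x) \<le> 0"
    using closest_point_eq_iff_dot[OF convex_prob_simplex closed_prob_simplex x, of z] x_def by blast
  then have nc: "(z - x) $ i \<le> (z - x) \<bullet> x" "0 < x $ i \<Longrightarrow> (z - x) $ i = (z - x) \<bullet> x" for i
    using prob_simplex_normal_cone[OF x] by blast+
  define \<tau> where "\<tau> = (z - x) \<bullet> x"
  have pos: "z $ i = x $ i + \<tau>" if "0 < x $ i" for i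
    using nc(2)[OF that] by (simp add: \<tau>_def)
  moreover have "z $ i < \<tau>" if "x $ i = 0" for i
  proof (rule ccontr)
    assume "\<not> z $ i < \<tau>"
    then have "z $ i = \<tau>" using nc(1)[of i] that by (simp add: \<tau>_def)
    define B where "B = {i. 0 < x $ i}"
    have "(\<Sum>j\<in>B. x $ j) = (\<Sum>j\<in>UNIV. x $ j)"
      using prob_simplex_nonneg[OF x] by (intro sum.mono_neutral_left) (auto simp: B_def less_le)
    moreover have "(\<Sum>j\<in>B. z $ j) = (\<Sum>j\<in>B. x $ j + \<tau>)"
      using pos by (intro sum.cong) (auto simp: B_def)
    ultimately have "(\<Sum>j\<in>B. z $ j) = 1 + card B * \<tau>"
      by (simp add: sum.distrib prob_simplex_sum[OF x])
    then have "z \<in> degenerate_points"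
      unfolding degenerate_points_def using \<open>z $ i = \<tau>\<close> prob_simplex_support_nonempty[OF x]
      by (auto simp: B_def intro!: exI[of _ B] exI[of _ i])
    with assms show False by simp
  qed
  ultimately show thesis by (rule that)
qed

section \<open>Solutions of the variational inequality\<close>

text \<open>A recipe for kernel vectors. Orthogonality of \<open>v\<close> to \<open>x\<close> makes
  the right-hand projection fix \<open>v\<close> and kills the rank-one term. The middle factor then
  sends \<open>v\<close> to a multiple of the all-ones vector, which the left-hand projection
  annihilates.\<close>

lemma J_mat_mult_eq_0:
  fixes x v :: "real ^ 'n"
  assumes x: "x \<in> prob_simplex" and xv: "x \<bullet> v = 0"
    and M: "\<And>i. (jacobian G (at x) *v (\<chi> j. x $ j * v $ j)) $ i + (G x $ i - x \<bullet> G x) * v $ i = c"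
  shows "J_mat k G x *v v = 0"
proof -
  have outer: "outer_product 1 x *v y = (x \<bullet> y) *\<^sub>R 1" for y :: "real ^ 'n"
    by (simp add: outer_product_def matrix_vector_mult_def vec_eq_iff inner_vec_def)
  have proj: "simplex_proj x *v y = y - (x \<bullet> y) *\<^sub>R 1" for y :: "real ^ 'n"
    by (simp add: simplex_proj_def matrix_vector_mult_diff_rdistrib outer)
  have diag: "diag_mat b *v y = (\<chi> i. b $ i * y $ i)" for b y :: "real ^ 'n"
    by (simp add: diag_mat_def matrix_vector_mult_def vec_eq_iff if_distrib[of "\<lambda>x. x * _"] cong: if_cong)
  have "(mat_circ_vec (jacobian G (at x)) x + vec_circ_mat (simplex_proj x *v G x) (mat 1)) *v v
      = jacobian G (at x) *v (\<chi> j. x $ j * v $ j) + (\<chi> i. (G x $ i - x \<bullet> G x) * v $ i)"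
    by (simp add: mat_circ_vec_def vec_circ_mat_def matrix_vector_mult_add_rdistrib diag proj
        flip: matrix_vector_mul_assoc)
  also have "\<dots> = c *\<^sub>R 1"
    using M by (simp add: vec_eq_iff)
  finally have "J_mat k G x *v v = simplex_proj x *v (c *\<^sub>R 1)"
    using xv by (simp add: J_mat_def matrix_vector_mult_add_rdistrib outer proj
        flip: matrix_vector_mul_assoc scaleR_matrix_vector_assoc)
  also have "\<dots> = 0"
    using prob_simplex_sum[OF x] by (simp add: proj inner_vec_def flip: sum_distrib_right)
  finally show ?thesis .
qed

lemma invertible_imp_ker_trivial:
  fixes A :: "real ^ 'n ^ 'n"
  shows "invertible A \<Longrightarrow> A *v v = 0 \<Longrightarrow> v = 0"
  by (metis invertible_left_inverse matrix_left_invertible_ker)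

text \<open>Otherwise \<open>axis i 1\<close> is a kernel vector: \<open>x $ i = 0\<close> removes
  its Jacobian term and equality removes its diagonal term.\<close>

lemma invertible_J_mat_strict_complementarity:
  fixes x :: "real ^ 'n"
  assumes x: "x \<in> prob_simplex" and J: "invertible (J_mat k G x)" and "x $ i = 0"
  shows "G x $ i \<noteq> x \<bullet> G x"
proof
  assume "G x $ i = x \<bullet> G x"
  have zero: "(\<chi> j. x $ j * axis i 1 $ j) = (0 :: real ^ 'n)"
    using \<open>x $ i = 0\<close> by (simp add: vec_eq_iff axis_def)
  have "J_mat k G x *v axis i 1 = 0"
  proof (rule J_mat_mult_eq_0[OF x])
    show "x \<bullet> axis i 1 = 0" using \<open>x $ i = 0\<close> by (simp add: inner_axis)
    show "(jacobian G (at x) *v (\<chi> j. x $ j * axis i 1 $ j)) $ l + (G x $ l - x \<bullet> G x) * axis i 1 $ l = 0" for l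
      unfolding zero using \<open>G x $ i = x \<bullet> G x\<close> by (cases "l = i") (auto simp: axis_def)
  qed
  then have "axis i (1 :: real) = 0" by (rule invertible_imp_ker_trivial[OF J])
  then show False by simp
qed

text \<open>Here \<open>u\<close> is tangent to the face of \<open>x\<close>, and its Jacobian image
  is constant on the support. Dividing by \<open>x\<close> there, and off the support solving the
  remaining equations, whose coefficients are nonzero by strict complementarity, extends
  \<open>u\<close> to a kernel vector \<open>v\<close> of \<open>J_mat k G x\<close>.\<close>

lemma invertible_J_mat_reduced_inj:
  fixes x u :: "real ^ 'n"
  assumes x: "x \<in> prob_simplex" and J: "invertible (J_mat k G x)"
    and sol: "\<And>i. 0 < x $ i \<Longrightarrow> G x $ i = x \<bullet> G x"
    and u: "\<And>i. x $ i = 0 \<Longrightarrow> u $ i = 0" "(\<Sum>i\<in>UNIV. u $ i) = 0"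
    and c: "\<And>i. 0 < x $ i \<Longrightarrow> (jacobian G (at x) *v u) $ i = c"
  shows "u = 0"
proof -
  define v :: "real ^ 'n" where "v = (\<chi> i. if x $ i = 0
      then (c - (jacobian G (at x) *v u) $ i) / (G x $ i - x \<bullet> G x) else u $ i / x $ i)"
  have xv: "(\<chi> j. x $ j * v $ j) = u"
    using u(1) by (simp add: vec_eq_iff v_def)
  have "x \<bullet> v = (\<Sum>i\<in>UNIV. (\<chi> j. x $ j * v $ j) $ i)" by (simp add: inner_vec_def)
  then have "x \<bullet> v = 0" unfolding xv using u(2) by simp
  have "J_mat k G x *v v = 0"
  proof (rule J_mat_mult_eq_0[OF x \<open>x \<bullet> v = 0\<close>])
    fix i
    show "(jacobian G (at x) *v (\<chi> j. x $ j * v $ j)) $ i + (G x $ i - x \<bullet> G x) * v $ i = c"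
    proof (cases "x $ i = 0")
      case True
      then show ?thesis
        using invertible_J_mat_strict_complementarity[OF x J True] unfolding xv by (simp add: v_def)
    next
      case False
      then have "0 < x $ i" using prob_simplex_nonneg[OF x, of i] by simp
      then show ?thesis unfolding xv by (simp add: sol c)
    qed
  qed
  then have "v = 0" using invertible_imp_ker_trivial[OF J] by blast
  then show ?thesis using xv by (simp add: vec_eq_iff)
qed


section \<open>Global Lipschitz bounds and cutting off at infinity\<close>

lemma compact_Lipschitz_if_has_strict_derivative:
  fixes f :: "'a::real_normed_vector \<Rightarrow> 'b::real_normed_vector"
  assumes "compact S" and strict: "\<And>x. x \<in> S \<Longrightarrow> \<exists>A. has_strict_derivative f A x"
  obtains L where "L \<ge> 0" "\<And>x y. x \<in> S \<Longrightarrow> y \<in> S \<Longrightarrow> norm (f x - f y) \<le> L * norm (x - y)"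
proof -
  \<comment> \<open>The time variable of \<open>local_lipschitz\<close> is a dummy ranging over
    \<open>{0}\<close>.\<close>
  have "local_lipschitz {0::real} S (\<lambda>_. f)"
  proof (rule local_lipschitzI)
    fix t x assume "x \<in> S"
    then obtain A where "has_strict_derivative f A x" using strict by blast
    then obtain d B where dB: "d > 0" "B > 0"
      "\<And>y z. y \<in> ball x d \<Longrightarrow> z \<in> ball x d \<Longrightarrow> norm (f y - f z) \<le> B * norm (y - z)"
      using has_strict_derivative_locally_Lipschitz by blast
    have "B-lipschitz_on (cball x (d / 2) \<inter> S) f"
      using dB by (intro lipschitz_onI) (auto simp: dist_norm)
    then show "\<exists>u>0. \<exists>L. \<forall>t\<in>cball t u \<inter> {0}. L-lipschitz_on (cball x u \<inter> S) f"
      using \<open>d > 0\<close> by (intro exI[of _ "d / 2"]) auto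
  qed
  then obtain L where "L-lipschitz_on S f"
    using local_lipschitz_compact_implies_lipschitz[of "{0::real}" S "\<lambda>_. f"] \<open>compact S\<close> by auto
  then show thesis
    by (intro that[of L]) (auto simp: lipschitz_on_def dist_norm)
qed

text \<open>A piecewise linear profile in the norm: 1 up to radius \<open>R\<close>, 0 from
  \<open>2 * R\<close> on. It is Lipschitz and differentiable off two spheres, which is the
  regularity that \<open>odd_card_zeros\<close> asks for away from zeros.\<close>

definition cutoff :: "real \<Rightarrow> 'a::real_inner \<Rightarrow> real" where
  "cutoff R z = max 0 (min 1 (2 - norm z / R))"

lemma cutoff_bounds: "0 \<le> cutoff R z" "cutoff R z \<le> 1"
  by (auto simp: cutoff_def)

lemma cutoff_Lipschitz:
  assumes "R > 0"
  shows "\<bar>cutoff R x - cutoff R y\<bar> \<le> norm (x - y) / R"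
proof -
  have "\<bar>cutoff R x - cutoff R y\<bar> \<le> \<bar>norm x / R - norm y / R\<bar>"
    unfolding cutoff_def by (auto simp: max_def min_def)
  also have "\<dots> = \<bar>norm x - norm y\<bar> / R"
    using assms by (simp add: abs_divide flip: diff_divide_distrib)
  also have "\<dots> \<le> norm (x - y) / R"
    using assms by (intro divide_right_mono norm_triangle_ineq3) auto
  finally show ?thesis .
qed

lemma cutoff_eq_1: "R > 0 \<Longrightarrow> norm z \<le> R \<Longrightarrow> cutoff R z = 1"
  and cutoff_eq_0: "R > 0 \<Longrightarrow> 2 * R \<le> norm z \<Longrightarrow> cutoff R z = 0"
  by (auto simp: cutoff_def min_def max_def field_simps)

lemma cutoff_differentiable:
  fixes z :: "'a::real_inner"
  assumes "R > 0" "norm z \<noteq> R" "norm z \<noteq> 2 * R"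
  shows "cutoff R differentiable (at z)"
proof -
  have transform: "cutoff R differentiable (at z)"
    if S: "open S" "z \<in> S" and f: "f differentiable (at z)" and eq: "\<And>y. y \<in> S \<Longrightarrow> f y = cutoff R y"
    for f S
  proof -
    obtain D where D: "(f has_derivative D) (at z)"
      using f by (auto simp: differentiable_def)
    show ?thesis
      by (rule differentiableI, rule has_derivative_transform_within_open[OF D S]) (rule eq)
  qed
  have S: "open {y :: 'a. norm y < R}" "open {y :: 'a. R < norm y \<and> norm y < 2 * R}"
    "open {y :: 'a. 2 * R < norm y}"
    by (auto intro!: open_Collect_less open_Collect_conj continuous_intros)
  consider "norm z < R" | "R < norm z" "norm z < 2 * R" | "2 * R < norm z"
    using assms by linarith
  then show ?thesis
  proof cases
    case 1
    then show ?thesis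
      by (intro transform[OF S(1), of "\<lambda>_. 1"]) (use \<open>R > 0\<close> in \<open>auto simp: cutoff_eq_1\<close>)
  next
    case 2
    then have "z \<noteq> 0" using \<open>R > 0\<close> by auto
    have "(\<lambda>y. 2 - norm y / R) differentiable (at z)"
      using differentiable_norm_at[OF \<open>z \<noteq> 0\<close>] \<open>R > 0\<close>
      by (intro differentiable_diff differentiable_const differentiable_divide) auto
    with 2 show ?thesis
      by (intro transform[OF S(2), of "\<lambda>y. 2 - norm y / R"])
        (use \<open>R > 0\<close> in \<open>auto simp: cutoff_def min_def max_def field_simps\<close>)
  next
    case 3
    then show ?thesis
      by (intro transform[OF S(3), of "\<lambda>_. 0"]) (use \<open>R > 0\<close> in \<open>auto simp: cutoff_eq_0\<close>)
  qed
qed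

section \<open>The normal map and the count of solutions\<close>

lemma VI_solutions_prob_simplex_iff:
  fixes G :: "real ^ 'n \<Rightarrow> real ^ 'n"
  assumes "x \<in> prob_simplex"
  shows "x \<in> VI_solutions G prob_simplex \<longleftrightarrow> closest_point prob_simplex (x - G x) = x"
  unfolding closest_point_eq_iff_dot[OF convex_prob_simplex closed_prob_simplex assms]
  using assms by (auto simp: VI_solutions_def)

text \<open>The inverse bijection is \<open>x \<mapsto> x - G x\<close>. The normal map is defined
  on the whole space but evaluates \<open>G\<close> only on the simplex.\<close>

lemma VI_solutions_bij_normal_map_zeros:
  fixes G :: "real ^ 'n \<Rightarrow> real ^ 'n"
  shows "bij_betw (closest_point prob_simplex)
    {z. z - closest_point prob_simplex z + G (closest_point prob_simplex z) = 0}
    (VI_solutions G prob_simplex)"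
proof (rule bij_betw_byWitness[where f' = "\<lambda>x. x - G x"])
  let ?P = "closest_point (prob_simplex :: (real ^ 'n) set)"
  have P: "?P z \<in> prob_simplex" for z
    using axis_in_prob_simplex by (intro closest_point_in_set closed_prob_simplex) auto
  have fp: "x \<in> prob_simplex \<and> ?P (x - G x) = x" if "x \<in> VI_solutions G prob_simplex" for x
  proof -
    have "x \<in> prob_simplex" using that by (simp add: VI_solutions_def)
    then show ?thesis using that VI_solutions_prob_simplex_iff by blast
  qed
  have zero: "?P z - G (?P z) = z" if "z - ?P z + G (?P z) = 0" for z
    using that by (simp add: algebra_simps)
  show "\<forall>z\<in>{z. z - ?P z + G (?P z) = 0}. ?P z - G (?P z) = z"
    using zero by blast
  show "\<forall>x\<in>VI_solutions G prob_simplex. ?P (x - G x) = x"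
    using fp by blast
  show "?P ` {z. z - ?P z + G (?P z) = 0} \<subseteq> VI_solutions G prob_simplex"
  proof (rule image_subsetI)
    fix z assume "z \<in> {z. z - ?P z + G (?P z) = 0}"
    then have "?P (?P z - G (?P z)) = ?P z" using zero[of z] by simp
    then show "?P z \<in> VI_solutions G prob_simplex"
      using VI_solutions_prob_simplex_iff[OF P] by blast
  qed
  show "(\<lambda>x. x - G x) ` VI_solutions G prob_simplex \<subseteq> {z. z - ?P z + G (?P z) = 0}"
    using fp by auto
qed

text \<open>Strict complementarity makes the projection affine near \<open>x - G x\<close> with
  linear part \<open>L\<close>, so the derivative sends \<open>w\<close> to
  \<open>w - L w + ?D *v L w\<close>. For \<open>w\<close> in its kernel,
  \<open>?D *v L w = L w - w\<close> is constant on the support; reduced injectivity gives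
  \<open>L w = 0\<close>, and then \<open>w = 0\<close>.\<close>

lemma normal_map_has_strict_derivative:
  fixes G :: "real ^ 'n \<Rightarrow> real ^ 'n"
  assumes sol: "x \<in> VI_solutions G prob_simplex"
    and G: "has_strict_derivative G ((*v) (jacobian G (at x))) x"
    and J: "invertible (J_mat k G x)"
  shows "\<exists>A. has_strict_derivative
      (\<lambda>z. z - closest_point prob_simplex z + G (closest_point prob_simplex z)) A (x - G x) \<and> inj A"
proof -
  let ?P = "closest_point (prob_simplex :: (real ^ 'n) set)"
  define B where "B = {i. 0 < x $ i}"
  define L where "L = (face_proj B :: real ^ 'n \<Rightarrow> real ^ 'n)"
  interpret L: bounded_linear L
    unfolding L_def by (rule bounded_linear_face_proj)
  let ?D = "jacobian G (at x)"
  define A where "A w = w - L w + ?D *v L w" for w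
  have x: "x \<in> prob_simplex" using sol by (simp add: VI_solutions_def)
  have "\<forall>y\<in>prob_simplex. (- G x) \<bullet> (y - x) \<le> 0"
    using sol by (auto simp: VI_solutions_def)
  then have G_le: "x \<bullet> G x \<le> G x $ i" and G_eq: "0 < x $ i \<Longrightarrow> G x $ i = x \<bullet> G x" for i
    unfolding prob_simplex_normal_cone[OF x] by (auto simp: inner_commute)
  have G_less: "x \<bullet> G x < G x $ i" if "x $ i = 0" for i
    using G_le[of i] invertible_J_mat_strict_complementarity[OF x J that] by simp
  \<comment> \<open>The multiplier of the projection at \<open>x - G x\<close> is
    \<open>- (x \<bullet> G x)\<close>.\<close>
  have pos: "(x - G x) $ i = x $ i + - (x \<bullet> G x)" if "0 < x $ i" for i
    using G_eq[OF that] by simp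
  have zero: "(x - G x) $ i < - (x \<bullet> G x)" if "x $ i = 0" for i
    using G_less[OF that] that by simp
  obtain d where "d > 0" and d: "\<And>z. z \<in> ball (x - G x) d \<Longrightarrow> ?P z = x + L (z - (x - G x))"
    using closest_point_prob_simplex_locally_affine[OF x pos zero] unfolding L_def B_def by blast
  obtain K where K: "K > 0" "\<And>w. norm (L w) \<le> norm w * K" using L.pos_bounded by blast
  have "has_strict_derivative (\<lambda>z. z - ?P z + G (?P z)) A (x - G x)"
  proof (rule has_strict_derivativeI)
    show "bounded_linear A"
      unfolding A_def
      by (intro bounded_linear_add bounded_linear_sub bounded_linear_ident L.bounded_linear_axioms
          bounded_linear_compose[OF matrix_vector_mul_bounded_linear L.bounded_linear_axioms])
    \<comment> \<open>\<open>L\<close> stretches distances by at most \<open>K\<close>, so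
      \<open>G\<close> is controlled with error \<open>e / K\<close> and the radius is shrunk to
      \<open>\<delta> / K\<close>.\<close>
    fix e :: real assume "e > 0"
    then obtain \<delta> where "\<delta> > 0" and \<delta>: "\<And>y z. y \<in> ball x \<delta> \<Longrightarrow> z \<in> ball x \<delta> \<Longrightarrow>
        norm (G y - G z - ?D *v (y - z)) \<le> (e / K) * norm (y - z)"
      using has_strict_derivativeD[OF G, of "e / K"] K by auto
    have "norm ((y - ?P y + G (?P y)) - (z - ?P z + G (?P z)) - A (y - z)) \<le> e * norm (y - z)"
      if y: "y \<in> ball (x - G x) (min d (\<delta> / K))" and z: "z \<in> ball (x - G x) (min d (\<delta> / K))" for y z
    proof -
      have Py: "?P y = x + L (y - (x - G x))" and Pz: "?P z = x + L (z - (x - G x))"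
        using d y z by auto
      then have PL: "?P y - ?P z = L (y - z)" by (simp add: L.diff)
      have near: "x + L (u - (x - G x)) \<in> ball x \<delta>" if "u \<in> ball (x - G x) (min d (\<delta> / K))" for u
      proof -
        have "norm (L (u - (x - G x))) \<le> norm (u - (x - G x)) * K" by (rule K)
        also have "\<dots> < \<delta> / K * K"
          using that K by (intro mult_strict_right_mono) (auto simp: dist_norm norm_minus_commute)
        finally show ?thesis using K by (simp add: dist_norm)
      qed
      have "(y - ?P y + G (?P y)) - (z - ?P z + G (?P z)) - A (y - z)
          = G (?P y) - G (?P z) - ?D *v (?P y - ?P z)"
        by (simp add: A_def PL[symmetric])
      also have "norm \<dots> \<le> (e / K) * norm (?P y - ?P z)"
        using near[OF y] near[OF z] by (intro \<delta>) (simp_all only: Py Pz)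
      also have "\<dots> \<le> (e / K) * (norm (y - z) * K)"
        unfolding PL using \<open>e > 0\<close> K by (intro mult_left_mono) auto
      also have "\<dots> = e * norm (y - z)" using K by simp
      finally show ?thesis .
    qed
    then show "\<exists>d>0. \<forall>y\<in>ball (x - G x) d. \<forall>z\<in>ball (x - G x) d.
        norm ((y - ?P y + G (?P y)) - (z - ?P z + G (?P z)) - A (y - z)) \<le> e * norm (y - z)"
      using \<open>d > 0\<close> \<open>\<delta> > 0\<close> K by (intro exI[of _ "min d (\<delta> / K)"]) auto
  qed
  moreover have "inj A"
  proof -
    have A: "linear A"
      using \<open>has_strict_derivative _ A _\<close>
      by (intro bounded_linear.linear has_strict_derivative_bounded_linear)
    have "w = 0" if "A w = 0" for w
    proof -
      have Dw: "?D *v L w = L w - w" using that by (simp add: A_def algebra_simps)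
      have "L w = 0"
      proof (rule invertible_J_mat_reduced_inj[OF x J G_eq])
        show "L w $ i = 0" if "x $ i = 0" for i
          using that by (simp add: L_def face_proj_def B_def)
        show "(\<Sum>i\<in>UNIV. L w $ i) = 0"
          unfolding L_def B_def by (rule sum_face_proj[OF prob_simplex_support_nonempty[OF x]])
        show "(?D *v L w) $ i = - (\<Sum>j\<in>B. w $ j) / card B" if "0 < x $ i" for i
          unfolding Dw using that by (simp add: L_def face_proj_def B_def)
      qed auto
      with Dw show ?thesis by simp
    qed
    then show ?thesis using linear_injective_0[OF A] by blast
  qed
  ultimately show ?thesis by blast
qed

text \<open>The normal map is the identity minus the bounded map \<open>p\<close>. Cutting
  \<open>p\<close> off far away makes it the identity outside a ball without changing its zeros, so
  \<open>odd_card_zeros\<close> applies and the bijection transfers the count.\<close>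

theorem VI_solutions_odd_card:
  fixes G :: "real ^ 'n \<Rightarrow> real ^ 'n"
  assumes G: "\<And>x. x \<in> prob_simplex \<Longrightarrow> has_strict_derivative G ((*v) (jacobian G (at x))) x"
    and J: "\<And>x. x \<in> VI_solutions G prob_simplex \<Longrightarrow> invertible (J_mat k G x)"
  shows "finite (VI_solutions G prob_simplex) \<and> odd (card (VI_solutions G prob_simplex))"
proof -
  let ?P = "closest_point (prob_simplex :: (real ^ 'n) set)"
  have P: "?P z \<in> prob_simplex" for z
    using axis_in_prob_simplex by (intro closest_point_in_set closed_prob_simplex) auto
  define p where "p z = ?P z - G (?P z)" for z
  obtain L where L: "L \<ge> 0"
    "\<And>x y. x \<in> prob_simplex \<Longrightarrow> y \<in> prob_simplex \<Longrightarrow> norm (G x - G y) \<le> L * norm (x - y)"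
    using compact_Lipschitz_if_has_strict_derivative[OF compact_prob_simplex, of G] G by blast
  have p_lip: "norm (p x - p y) \<le> (1 + L) * norm (x - y)" for x y
  proof -
    have P_lip: "norm (?P x - ?P y) \<le> norm (x - y)"
      using closest_point_lipschitz[OF convex_prob_simplex closed_prob_simplex] axis_in_prob_simplex
      by (metis dist_norm empty_iff)
    have "p x - p y = (?P x - ?P y) - (G (?P x) - G (?P y))" by (simp add: p_def)
    also have "norm \<dots> \<le> norm (?P x - ?P y) + norm (G (?P x) - G (?P y))" by (rule norm_triangle_ineq4)
    also have "\<dots> \<le> norm (?P x - ?P y) + L * norm (?P x - ?P y)" using L(2)[OF P P] by simp
    also have "\<dots> = (1 + L) * norm (?P x - ?P y)" by (simp add: algebra_simps)
    also have "\<dots> \<le> (1 + L) * norm (x - y)" using P_lip L(1) by (intro mult_left_mono) auto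
    finally show ?thesis .
  qed
  have "continuous_on prob_simplex G"
    using G by (intro continuous_at_imp_continuous_on ballI has_derivative_continuous)
      (blast intro: has_strict_derivative_imp_has_derivative)
  then have "compact ((\<lambda>x. x - G x) ` prob_simplex)"
    by (intro compact_continuous_image compact_prob_simplex continuous_intros)
  then have "bounded ((\<lambda>x. x - G x) ` prob_simplex)" by (rule compact_imp_bounded)
  then obtain M where M: "\<And>x. x \<in> prob_simplex \<Longrightarrow> norm (x - G x) \<le> M"
    by (auto simp: bounded_iff)
  have p_le: "norm (p z) \<le> M" for z
    unfolding p_def by (rule M[OF P])
  have "M \<ge> 0" using norm_ge_zero[of "p 0"] p_le[of 0] by linarith
  \<comment> \<open>Zeros have norm at most \<open>M\<close>, so the unit ball around each zero
    stays where the cutoff is 1.\<close>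
  define R where "R = M + 1"
  have R: "R > 0" "M < R" using \<open>M \<ge> 0\<close> by (auto simp: R_def)
  define g where "g z = z - cutoff R z *\<^sub>R p z" for z
  have g_near: "g z = z - ?P z + G (?P z)" if "norm z \<le> R" for z
    using that R by (simp add: g_def cutoff_eq_1 p_def)
  have g_zero: "g z = 0 \<longleftrightarrow> z - ?P z + G (?P z) = 0" and zero_norm: "g z = 0 \<Longrightarrow> norm z \<le> M" for z
  proof -
    have *: "norm z \<le> M" if "g z = 0"
    proof -
      have "z = cutoff R z *\<^sub>R p z" using that by (simp add: g_def)
      then have "norm z = norm (cutoff R z *\<^sub>R p z)" by (rule arg_cong)
      also have "\<dots> = cutoff R z * norm (p z)" using cutoff_bounds(1)[of R z] by simp
      also have "\<dots> \<le> 1 * norm (p z)" using cutoff_bounds(2) by (intro mult_right_mono) auto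
      finally show ?thesis using p_le[of z] by simp
    qed
    then show "g z = 0 \<Longrightarrow> norm z \<le> M" .
    have "norm z \<le> M" if "z - ?P z + G (?P z) = 0"
    proof -
      have "z = p z" using that by (simp add: p_def algebra_simps)
      then show ?thesis using p_le[of z] by simp
    qed
    with * show "g z = 0 \<longleftrightarrow> z - ?P z + G (?P z) = 0" using g_near[of z] R by auto
  qed
  have "finite {z. g z = 0} \<and> odd (card {z. g z = 0})"
  proof (rule odd_card_zeros)
    \<comment> \<open>The identity contributes 1; the product contributes the constant
      \<open>1 + L\<close> of \<open>p\<close> times the bound 1 of the cutoff, and the bound
      \<open>M\<close> of \<open>p\<close> times the constant \<open>1 / R\<close> of the
      cutoff.\<close>
    show "norm (g x - g y) \<le> (1 + ((1 + L) + M / R)) * norm (x - y)" for x y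
    proof -
      have "cutoff R x *\<^sub>R p x - cutoff R y *\<^sub>R p y
          = cutoff R x *\<^sub>R (p x - p y) + (cutoff R x - cutoff R y) *\<^sub>R p y"
        by (simp add: algebra_simps)
      also have "norm \<dots> \<le> cutoff R x * norm (p x - p y) + \<bar>cutoff R x - cutoff R y\<bar> * norm (p y)"
        using cutoff_bounds(1)[of R x] by (intro order_trans[OF norm_triangle_ineq]) simp
      also have "\<dots> \<le> 1 * ((1 + L) * norm (x - y)) + norm (x - y) / R * M"
        using cutoff_bounds cutoff_Lipschitz[OF R(1)] p_lip p_le R \<open>M \<ge> 0\<close>
        by (intro add_mono mult_mono) auto
      finally have *: "norm (cutoff R x *\<^sub>R p x - cutoff R y *\<^sub>R p y) \<le> ((1 + L) + M / R) * norm (x - y)"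
        by (simp add: algebra_simps)
      have "g x - g y = (x - y) - (cutoff R x *\<^sub>R p x - cutoff R y *\<^sub>R p y)"
        by (simp add: g_def)
      also have "norm \<dots> \<le> norm (x - y) + norm (cutoff R x *\<^sub>R p x - cutoff R y *\<^sub>R p y)"
        by (rule norm_triangle_ineq4)
      finally show ?thesis using * by (simp add: algebra_simps)
    qed
    show "2 * R > 0" using R by simp
    show "g z = z" if "2 * R \<le> norm z" for z
      using that R by (simp add: g_def cutoff_eq_0)
    \<comment> \<open>The projection may fail to be differentiable at degenerate points, the cutoff
      on the two spheres.\<close>
    show "negligible (degenerate_points \<union> sphere (0 :: real ^ 'n) R \<union> sphere 0 (2 * R))"
      by (intro negligible_Un negligible_degenerate_points negligible_sphere)
    show "g differentiable (at z)"
      if z: "z \<notin> degenerate_points \<union> sphere 0 R \<union> sphere 0 (2 * R)" for z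
    proof -
      have zd: "z \<notin> degenerate_points" using z by blast
      obtain \<tau> where "\<And>i. 0 < ?P z $ i \<Longrightarrow> z $ i = ?P z $ i + \<tau>" "\<And>i. ?P z $ i = 0 \<Longrightarrow> z $ i < \<tau>"
        using closest_point_prob_simplex_multiplier[OF zd] by blast
      then obtain d where d: "d > 0" "\<And>z'. z' \<in> ball z d \<Longrightarrow>
          ?P z' = ?P z + face_proj {i. 0 < ?P z $ i} (z' - z)"
        using closest_point_prob_simplex_locally_affine[OF P] by blast
      have "((\<lambda>z'. ?P z + face_proj {i. 0 < ?P z $ i} (z' - z)) has_derivative
          (\<lambda>w. face_proj {i. 0 < ?P z $ i} w)) (at z)"
        by (auto intro!: derivative_eq_intros bounded_linear.has_derivative[OF bounded_linear_face_proj])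
      then have "(?P has_derivative (\<lambda>w. face_proj {i. 0 < ?P z $ i} w)) (at z)"
      proof (rule has_derivative_transform_within_open[where s = "ball z d"])
        show "?P z + face_proj {i. 0 < ?P z $ i} (z' - z) = ?P z'" if "z' \<in> ball z d" for z'
          using d(2)[OF that] by (rule sym)
      qed (use d(1) in auto)
      then have dP: "?P differentiable (at z)" by (rule differentiableI)
      have "G differentiable (at (?P z))"
        using has_strict_derivative_imp_has_derivative[OF G[OF P]] by (rule differentiableI)
      then have "(\<lambda>z. G (?P z)) differentiable (at z)" using dP by (rule differentiable_compose)
      moreover have "cutoff R differentiable (at z)"
        using z R by (intro cutoff_differentiable) auto
      ultimately show ?thesis
        unfolding g_def p_def
        using dP by (intro differentiable_diff differentiable_scaleR differentiable_ident)
    qed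
    show "\<exists>A. has_strict_derivative g A a \<and> inj A" if "g a = 0" for a
    proof -
      define x where "x = ?P a"
      have a: "a - ?P a + G (?P a) = 0" using that g_zero by blast
      then have sol: "x \<in> VI_solutions G prob_simplex"
        using bij_betwE[OF VI_solutions_bij_normal_map_zeros[of G]] by (simp add: x_def)
      have ax: "a = x - G x" using a by (simp add: x_def algebra_simps)
      obtain A where A: "has_strict_derivative (\<lambda>z. z - ?P z + G (?P z)) A a" "inj A"
        using normal_map_has_strict_derivative[OF sol G[OF P, of a, folded x_def] J[OF sol]]
        unfolding ax by blast
      have "has_strict_derivative g A a"
      proof (rule has_strict_derivativeI)
        show "bounded_linear A" using A(1) by (rule has_strict_derivative_bounded_linear)
        fix e :: real assume "e > 0"
        then obtain d where d: "d > 0" "\<And>y z. y \<in> ball a d \<Longrightarrow> z \<in> ball a d \<Longrightarrow>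
            norm ((y - ?P y + G (?P y)) - (z - ?P z + G (?P z)) - A (y - z)) \<le> e * norm (y - z)"
          using has_strict_derivativeD[OF A(1)] by metis
        have "norm y \<le> R" if "y \<in> ball a 1" for y
        proof -
          have "norm y \<le> norm a + norm (y - a)" using norm_triangle_ineq[of a "y - a"] by simp
          then show ?thesis
            using that zero_norm[OF \<open>g a = 0\<close>] by (simp add: R_def dist_norm norm_minus_commute)
        qed
        with d show "\<exists>d>0. \<forall>y\<in>ball a d. \<forall>z\<in>ball a d. norm (g y - g z - A (y - z)) \<le> e * norm (y - z)"
          by (intro exI[of _ "min d 1"]) (auto simp: g_near)
      qed
      with A show ?thesis by blast
    qed
  qed
  moreover have "{z. g z = 0} = {z. z - ?P z + G (?P z) = 0}" using g_zero by blast
  ultimately show ?thesis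
    using bij_betw_finite[OF VI_solutions_bij_normal_map_zeros[of G]]
      bij_betw_same_card[OF VI_solutions_bij_normal_map_zeros[of G]] by simp
qed

theorem theorem8:
  fixes F G :: "real ^ 'n \<Rightarrow> real ^ 'n" and k :: real
  assumes "analytic_extension F prob_simplex G"
    and "k \<noteq> 0"
    and "\<And>\<sigma>. \<sigma> \<in> VI_solutions F prob_simplex \<Longrightarrow> invertible (J_mat k G \<sigma>)"
  shows "finite (VI_solutions F prob_simplex) \<and> odd (card (VI_solutions F prob_simplex))"
proof -
  \<comment> \<open>The inequality evaluates its map only on the simplex, where \<open>F\<close> and
    \<open>G\<close> agree.\<close>
  have eq: "VI_solutions F prob_simplex = VI_solutions G prob_simplex"
    using assms(1) by (auto simp: VI_solutions_def analytic_extension_def)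
  have "has_strict_derivative G ((*v) (jacobian G (at x))) x" if "x \<in> prob_simplex" for x
  proof -
    have "real_analytic_at G x"
      using assms(1) that by (auto simp: analytic_extension_def real_analytic_on_def)
    then obtain A where A: "has_strict_derivative G A x"
      by (rule real_analytic_at_imp_has_strict_derivative)
    then have "(G has_derivative A) (at x)" by (rule has_strict_derivative_imp_has_derivative)
    \<comment> \<open>By uniqueness of derivatives, the strict derivative read off from the power
      series is the Jacobian entering \<open>J_mat\<close>.\<close>
    then have "jacobian G (at x) *v w = A w" for w
      using matrix_mult_has_derivative[of G A] frechet_derivative_at[of G A x]
      by (simp add: jacobian_def)
    then have "(*v) (jacobian G (at x)) = A" by blast
    with A show ?thesis by simp
  qed
  with assms(3) show ?thesis
    unfolding eq by (intro VI_solutions_odd_card)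
qed

end
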